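(* Let $S$ be the Phillips symmetric operator with deficiency indices $\langle2,2\rangle$ in $\mathfrak{H}$, and let $J$ be a fundamental symmetry in $\mathfrak{H}$ commuting with $S$. Then a $J$-self-adjoint extension $B$ of $S$ has the property of stable $C$-symmetry if and only if the spectrum of $B$ is real.
   Context: Phillips symmetric operator: let $U$ be a unitary operator in a Hilbert space $\mathfrak{H}$ which is a bilateral shift with a wandering subspace $W_0$ (the subspaces $U^nW_0$, $n\in\mathbb{Z}$, are mutually orthogonal with orthogonal sum $\mathfrak{H}$); $V=U\upharpoonright(\mathfrak{H}\ominus W_0)$, $S=i(V+I)(V-I)^{-1}$, $\mathcal{D}(S)=\mathcal{R}(V-I)$; its deficiency indices are $\langle\dim W_0,\dim W_0\rangle$, so here $\dim W_0=2$. A fundamental symmetry is a bounded $J$ with $J=J^*$, $J^2=I$. A (possibly unbounded) operator $T$ commutes with a bounded operator $C$ if $C\mathcal{D}(T)\subset\mathcal{D}(T)$ and $TCu=CTu$ for $u\in\mathcal{D}(T)$. A densely defined operator $B$ is $J$-self-adjoint if $B^*J=JB$. A $J$-self-adjoint extension $B\supset S$ has the property of stable $C$-symmetry if there is a bounded operator $C$ in $\mathfrak{H}$ with $C^2=I$, $JC>0$ (positive self-adjoint), such that $C$ commutes with $B$ and also commutes with $S$. *)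

theory Defs
  imports "HOL-Analysis.Analysis"
begin

class complex_vector = real_vector +
  fixes scaleC :: "complex \<Rightarrow> 'a \<Rightarrow> 'a"
  assumes scaleR_scaleC: "scaleR r x = scaleC (complex_of_real r) x"
    and scaleC_add_right: "scaleC a (x + y) = scaleC a x + scaleC a y"
    and scaleC_add_left: "scaleC (a + b) x = scaleC a x + scaleC b x"
    and scaleC_scaleC: "scaleC a (scaleC b x) = scaleC (a * b) x"
    and scaleC_one: "scaleC 1 x = x"

class complex_inner = complex_vector + real_normed_vector +
  fixes cinner :: "'a \<Rightarrow> 'a \<Rightarrow> complex"
  assumes cinner_commute: "cinner x y = cnj (cinner y x)"
    and cinner_add_left: "cinner (x + y) z = cinner x z + cinner y z"
    and cinner_scaleC_left: "cinner (scaleC r x) y = cnj r * cinner x y"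
    and cinner_self_real: "Im (cinner x x) = 0"
    and cinner_self_nonneg: "0 \<le> Re (cinner x x)"
    and cinner_self_eq_zero: "cinner x x = 0 \<longleftrightarrow> x = 0"
    and norm_eq_sqrt_cinner: "norm x = sqrt (Re (cinner x x))"

class chilbert = complex_inner + complete_space

definition csubspace :: "'a::complex_vector set \<Rightarrow> bool" where
  "csubspace W \<longleftrightarrow> 0 \<in> W \<and> (\<forall>x\<in>W. \<forall>y\<in>W. x + y \<in> W) \<and> (\<forall>c. \<forall>x\<in>W. scaleC c x \<in> W)"

definition cspan :: "'a::complex_vector set \<Rightarrow> 'a set" where
  "cspan A = {x. \<exists>F c. finite F \<and> F \<subseteq> A \<and> x = (\<Sum>a\<in>F. scaleC (c a) a)}"

definition cindependent :: "'a::complex_vector set \<Rightarrow> bool" where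
  "cindependent A \<longleftrightarrow> (\<forall>F c. finite F \<and> F \<subseteq> A \<and> (\<Sum>a\<in>F. scaleC (c a) a) = 0 \<longrightarrow> (\<forall>a\<in>F. c a = 0))"

definition cdim_is :: "'a::complex_vector set \<Rightarrow> nat \<Rightarrow> bool" where
  "cdim_is W n \<longleftrightarrow> (\<exists>B. finite B \<and> card B = n \<and> cindependent B \<and> cspan B = W)"

definition clinear :: "('a::complex_vector \<Rightarrow> 'b::complex_vector) \<Rightarrow> bool" where
  "clinear f \<longleftrightarrow> (\<forall>x y. f (x + y) = f x + f y) \<and> (\<forall>c x. f (scaleC c x) = scaleC c (f x))"

definition cbounded_linear :: "('a::complex_inner \<Rightarrow> 'a) \<Rightarrow> bool" where
  "cbounded_linear f \<longleftrightarrow> clinear f \<and> (\<exists>K. \<forall>x. norm (f x) \<le> K * norm x)"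

definition ortho_compl :: "'a::complex_inner set \<Rightarrow> 'a set" where
  "ortho_compl W = {x. \<forall>w\<in>W. cinner w x = 0}"

definition unitary :: "('a::complex_inner \<Rightarrow> 'a) \<Rightarrow> bool" where
  "unitary U \<longleftrightarrow> cbounded_linear U \<and> surj U \<and> (\<forall>x y. cinner (U x) (U y) = cinner x y)"

definition zpow :: "('a \<Rightarrow> 'a) \<Rightarrow> int \<Rightarrow> 'a \<Rightarrow> 'a" where
  "zpow U n = (if 0 \<le> n then U ^^ nat n else (inv U) ^^ nat (- n))"

definition bilateral_shift :: "('a::chilbert \<Rightarrow> 'a) \<Rightarrow> 'a set \<Rightarrow> bool" where
  "bilateral_shift U W0 \<longleftrightarrow> unitary U \<and> csubspace W0 \<and> closed W0 \<and>
     (\<forall>m n. m \<noteq> n \<longrightarrow> (\<forall>x\<in>zpow U m ` W0. \<forall>y\<in>zpow U n ` W0. cinner x y = 0)) \<and>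
     closure (cspan (\<Union>n. zpow U n ` W0)) = UNIV"

text \<open>Unbounded operators are represented by their graphs.\<close>
type_synonym 'a operator = "('a \<times> 'a) set"

text \<open>Graph of \<open>S = i(V+I)(V-I)^{-1}\<close>, \<open>V = U\<restriction>(H \<ominus> W0)\<close>, \<open>D(S) = R(V - I)\<close>.\<close>
definition phillips_op :: "('a::chilbert \<Rightarrow> 'a) \<Rightarrow> 'a set \<Rightarrow> 'a operator" where
  "phillips_op U W0 = {(U x - x, scaleC \<i> (U x + x)) | x. x \<in> ortho_compl W0}"

definition is_operator :: "'a::complex_vector operator \<Rightarrow> bool" where
  "is_operator T \<longleftrightarrow> (0, 0) \<in> T \<and>
     (\<forall>x y x' y'. (x, y) \<in> T \<and> (x', y') \<in> T \<longrightarrow> (x + x', y + y') \<in> T) \<and>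
     (\<forall>c x y. (x, y) \<in> T \<longrightarrow> (scaleC c x, scaleC c y) \<in> T) \<and>
     (\<forall>y. (0, y) \<in> T \<longrightarrow> y = 0)"

definition app :: "'a operator \<Rightarrow> 'a \<Rightarrow> 'a" where
  "app T x = (THE y. (x, y) \<in> T)"

definition densely_defined :: "'a::complex_inner operator \<Rightarrow> bool" where
  "densely_defined T \<longleftrightarrow> closure (Domain T) = UNIV"

definition adjoint :: "'a::complex_inner operator \<Rightarrow> 'a operator" where
  "adjoint T = {(y, z). \<forall>(x, w)\<in>T. cinner w y = cinner x z}"

definition fundamental_symmetry :: "('a::complex_inner \<Rightarrow> 'a) \<Rightarrow> bool" where
  "fundamental_symmetry J \<longleftrightarrow> cbounded_linear J \<and> (\<forall>x y. cinner (J x) y = cinner x (J y)) \<and>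
     (\<forall>x. J (J x) = x)"

definition commutes :: "'a operator \<Rightarrow> ('a \<Rightarrow> 'a) \<Rightarrow> bool" where
  "commutes T C \<longleftrightarrow> (\<forall>u\<in>Domain T. C u \<in> Domain T \<and> app T (C u) = C (app T u))"

text \<open>\<open>B\<close> densely defined and \<open>B^* J = J B\<close> (as operators, domains included).\<close>
definition J_selfadjoint :: "('a::complex_inner \<Rightarrow> 'a) \<Rightarrow> 'a operator \<Rightarrow> bool" where
  "J_selfadjoint J B \<longleftrightarrow> is_operator B \<and> densely_defined B \<and>
     {(u, v). (J u, v) \<in> adjoint B} = {(u, J w) | u w. (u, w) \<in> B}"

definition positive_op :: "('a::complex_inner \<Rightarrow> 'a) \<Rightarrow> bool" where
  "positive_op A \<longleftrightarrow> cbounded_linear A \<and> (\<forall>x y. cinner (A x) y = cinner x (A y)) \<and>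
     (\<forall>x. x \<noteq> 0 \<longrightarrow> Im (cinner (A x) x) = 0 \<and> 0 < Re (cinner (A x) x))"

definition stable_C_symmetry :: "('a::complex_inner \<Rightarrow> 'a) \<Rightarrow> 'a operator \<Rightarrow> 'a operator \<Rightarrow> bool" where
  "stable_C_symmetry J S B \<longleftrightarrow> (\<exists>C. cbounded_linear C \<and> (\<forall>x. C (C x) = x) \<and>
     positive_op (J \<circ> C) \<and> commutes B C \<and> commutes S C)"

definition resolvent_set :: "'a::complex_inner operator \<Rightarrow> complex set" where
  "resolvent_set B = {l. (\<forall>y. \<exists>!x. x \<in> Domain B \<and> app B x - scaleC l x = y) \<and>
     (\<exists>K. \<forall>x\<in>Domain B. norm x \<le> K * norm (app B x - scaleC l x))}"

definition spectrum_op :: "'a::complex_inner operator \<Rightarrow> complex set" where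
  "spectrum_op B = - resolvent_set B"

end

theory Submission
  imports Defs
begin

text \<open>
  If \<open>B\<close> has a \<open>C\<close>-symmetry, then \<open>\<langle>J C x, y\<rangle>\<close> is an equivalent inner product in which \<open>B\<close> is
  self-adjoint, so the spectrum of \<open>B\<close> is real.

  Conversely, if \<open>i\<close> and \<open>-i\<close> are regular points of \<open>B\<close>, the Cayley transform \<open>K = (B + i)(B - i)^-1\<close>
  is bounded with a bounded inverse \<open>L\<close>. It agrees with \<open>U\<close> on the orthogonal complement of \<open>W0\<close> and
  maps \<open>W0\<close> onto \<open>U W0\<close>, and \<open>K^* J K = J\<close>. Hence \<open>Y = K J L - J\<close> lives on the single
  subspace \<open>U W0\<close>, and spreading it along the forward half of the shift gives
  \<open>C = J + (\<Sum>n\<ge>0. U^n Y U^-n)\<close>, which commutes with \<open>K\<close> and with the part of \<open>U\<close> outside \<open>W0\<close>.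
  Since \<open>J K J L = L^* L\<close>, the operator \<open>J C\<close> is the identity plus the sum of the copies of
  \<open>L^* L - I\<close> on the mutually orthogonal subspaces \<open>U^(n+1) W0\<close>, hence positive.
\<close>

section \<open>Complex Hilbert spaces\<close>

lemma clinear_linear: "clinear f \<Longrightarrow> linear f"
  by (rule linearI) (auto simp: clinear_def scaleR_scaleC)

interpretation cvec: vector_space "scaleC :: complex \<Rightarrow> 'a::complex_vector \<Rightarrow> 'a"
  by standard (auto simp: scaleC_add_right scaleC_add_left scaleC_scaleC scaleC_one)

lemma cinner_add_right: "cinner x (y + z) = cinner x y + cinner (x::'a::complex_inner) z"
  by (metis cinner_add_left cinner_commute complex_cnj_add)

lemma cinner_scaleC_right: "cinner x (scaleC c y) = c * cinner (x::'a::complex_inner) y"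
  by (metis cinner_scaleC_left cinner_commute complex_cnj_mult complex_cnj_cnj)

lemma cinner_self: "cinner x x = complex_of_real ((norm (x::'a::complex_inner))\<^sup>2)"
  by (simp add: complex_eq_iff cinner_self_real norm_eq_sqrt_cinner cinner_self_nonneg)

lemma cinner_diff_left: "cinner (x - y) z = cinner x z - cinner (y::'a::complex_inner) z"
  by (metis cinner_add_left diff_add_cancel add_diff_cancel)

lemma cinner_diff_right: "cinner x (y - z) = cinner x y - cinner (x::'a::complex_inner) z"
  by (metis cinner_add_right diff_add_cancel add_diff_cancel)

lemma cinner_zero_left [simp]: "cinner 0 (y::'a::complex_inner) = 0"
  using cinner_diff_left[of y y y] by simp

lemma cinner_zero_right [simp]: "cinner (y::'a::complex_inner) 0 = 0"
  using cinner_diff_right[of y y y] by simp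

lemma cinner_zero_commute: "cinner x y = 0 \<Longrightarrow> cinner y (x::'a::complex_inner) = 0"
  by (metis cinner_commute complex_cnj_zero)

lemma norm_scaleC: "norm (scaleC c x) = cmod c * norm (x::'a::complex_inner)"
proof -
  have "complex_of_real ((norm (scaleC c x))\<^sup>2) = cnj c * c * cinner x x"
    unfolding cinner_self[of "scaleC c x", symmetric]
    by (simp add: cinner_scaleC_left cinner_scaleC_right)
  also have "\<dots> = complex_of_real ((cmod c * norm x)\<^sup>2)"
    by (simp add: cinner_self power_mult_distrib complex_norm_square mult.commute del: of_real_power)
  finally show ?thesis
    by (simp only: of_real_eq_iff) (simp add: power2_eq_iff_nonneg)
qed

text \<open>The residual is orthogonal to \<open>w\<close>, so only its product with
  \<open>x\<close> survives. Nonnegativity of the left side yields Cauchy-Schwarz, and the size of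
  the drop drives the nearest-point argument below.\<close>

lemma norm_diff_projection:
  fixes x w :: "'a::complex_inner"
  assumes "w \<noteq> 0"
  shows "(norm (x - scaleC (cinner w x / cinner w w) w))\<^sup>2
    = (norm x)\<^sup>2 - (cmod (cinner w x))\<^sup>2 / (norm w)\<^sup>2"
proof -
  let ?t = "cinner w x / cinner w w"
  have nz: "cinner w w \<noteq> 0" using assms cinner_self_eq_zero by blast
  have a: "cinner w (x - scaleC ?t w) = 0"
    using nz by (simp add: cinner_diff_right cinner_scaleC_right)
  have "complex_of_real ((norm (x - scaleC ?t w))\<^sup>2) = cinner x (x - scaleC ?t w)"
    unfolding cinner_self[symmetric] cinner_diff_left[of x] cinner_scaleC_left a by simp
  also have "\<dots> = cinner x x - ?t * cnj (cinner w x)"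
    by (simp add: cinner_diff_right cinner_scaleC_right cinner_commute[of x w])
  also have "\<dots> = complex_of_real ((norm x)\<^sup>2 - (cmod (cinner w x))\<^sup>2 / (norm w)\<^sup>2)"
    by (simp add: cinner_self complex_norm_square del: of_real_power)
  finally show ?thesis by (simp only: of_real_eq_iff)
qed

lemma norm_cinner_le: "cmod (cinner x y) \<le> norm x * norm (y::'a::complex_inner)"
proof (cases "x = 0")
  case False
  then have "(cmod (cinner x y))\<^sup>2 / (norm x)\<^sup>2 \<le> (norm y)\<^sup>2"
    using norm_diff_projection[OF False, of y] zero_le_power2 by (metis diff_ge_0_iff_ge)
  then have "(cmod (cinner x y))\<^sup>2 \<le> (norm x * norm y)\<^sup>2"
    using False by (simp add: field_simps power_mult_distrib)
  then show ?thesis by (rule power2_le_imp_le) simp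
qed simp

lemma bounded_bilinear_cinner: "bounded_bilinear (cinner :: 'a::complex_inner \<Rightarrow> 'a \<Rightarrow> complex)"
proof
  show "\<exists>K. \<forall>a b. norm (cinner a (b::'a)) \<le> norm a * norm b * K"
    by (intro exI[of _ 1]) (simp add: norm_cinner_le)
qed (auto simp: cinner_add_left cinner_add_right scaleR_scaleC cinner_scaleC_left cinner_scaleC_right
    scaleR_conv_of_real)

lemma bounded_linear_scaleC: "bounded_linear (scaleC c :: 'a::complex_inner \<Rightarrow> 'a)"
  by (rule bounded_linear_intro[where K = "cmod c"])
     (auto simp: scaleC_add_right scaleR_scaleC scaleC_scaleC norm_scaleC mult.commute)

lemma cbounded_linear_bounded_linear: "cbounded_linear f \<Longrightarrow> bounded_linear f"
  using bounded_linear_intro[of f] unfolding cbounded_linear_def clinear_def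
  by (metis mult.commute scaleR_scaleC)

section \<open>Orthogonal projection onto closed subspaces\<close>

lemma parallelogram_law:
  "(norm (x + y))\<^sup>2 + (norm (x - y))\<^sup>2 = 2 * (norm x)\<^sup>2 + 2 * (norm (y::'a::complex_inner))\<^sup>2"
proof -
  have "complex_of_real ((norm (x + y))\<^sup>2 + (norm (x - y))\<^sup>2)
      = complex_of_real (2 * (norm x)\<^sup>2 + 2 * (norm y)\<^sup>2)"
    unfolding of_real_add of_real_mult cinner_self[symmetric]
    by (simp add: cinner_add_left cinner_add_right cinner_diff_left cinner_diff_right)
  then show ?thesis by (simp only: of_real_eq_iff)
qed

lemma csubspace_diff: "csubspace M \<Longrightarrow> x \<in> M \<Longrightarrow> y \<in> M \<Longrightarrow> x - y \<in> (M::'a::complex_vector set)"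
  unfolding csubspace_def
  by (metis cvec.scale_minus_left cvec.scale_one uminus_add_conv_diff add.commute)

subclass (in chilbert) banach ..

text \<open>The parallelogram law makes a distance-minimizing sequence in \<open>M\<close> Cauchy.
  Its limit is a nearest point of \<open>M\<close>, and a nearest point leaves a residual orthogonal
  to \<open>M\<close>.\<close>

theorem orthogonal_decomposition:
  fixes M :: "'a::chilbert set"
  assumes M: "csubspace M" "closed M"
  shows "\<exists>m\<in>M. x - m \<in> ortho_compl M"
proof -
  have ne: "M \<noteq> {}" and 0: "0 \<in> M" using M by (auto simp: csubspace_def)
  define d where "d = infdist x M"
  have d0: "d \<ge> 0" by (simp add: d_def infdist_nonneg)
  have dle: "d \<le> norm (x - m)" if "m \<in> M" for m
    using infdist_le[OF that, of x] by (simp add: d_def dist_norm)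
  have "\<exists>m\<in>M. norm (x - m) < d + 1 / Suc n" for n
    using infdist_notempty[OF ne, of x] cInf_lessD[of "dist x ` M" "d + 1 / Suc n"] ne
    by (auto simp: d_def dist_norm)
  then obtain m where m: "m n \<in> M" "norm (x - m n) < d + 1 / Suc n" for n
    by metis
  have half: "scaleR (1/2) (a + b) \<in> M" if "a \<in> M" "b \<in> M" for a b
    using that M by (auto simp: csubspace_def scaleR_scaleC)
  \<comment> \<open>The sum of \<open>x - a\<close> and \<open>x - b\<close> is twice the difference
    between \<open>x\<close> and the midpoint of \<open>a\<close> and \<open>b\<close>, so its norm
    is at least \<open>2 * d\<close>; the parallelogram law does the rest.\<close>
  have key: "(norm (a - b))\<^sup>2 \<le> 2 * (norm (x - a))\<^sup>2 + 2 * (norm (x - b))\<^sup>2 - 4 * d\<^sup>2"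
    if "a \<in> M" "b \<in> M" for a b
  proof -
    have "x - a + (x - b) = scaleR 2 (x - scaleR (1/2) (a + b))"
      by (simp add: algebra_simps scaleR_2)
    then have "norm (x - a + (x - b)) = 2 * norm (x - scaleR (1/2) (a + b))"
      by simp
    then have "2 * d \<le> norm (x - a + (x - b))"
      using dle[OF half[OF that]] by simp
    then have "(2 * d)\<^sup>2 \<le> (norm (x - a + (x - b)))\<^sup>2"
      using d0 by (intro power_mono) auto
    moreover have "x - a - (x - b) = b - a" by simp
    ultimately show ?thesis
      using parallelogram_law[of "x - a" "x - b"] by (simp add: norm_minus_commute power_mult_distrib)
  qed
  have lim: "(\<lambda>n. norm (x - m n)) \<longlonglongrightarrow> d"
  proof (rule real_tendsto_sandwich[of "\<lambda>_. d" _ _ "\<lambda>n. d + 1 / Suc n"])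
    show "(\<lambda>n. d + 1 / Suc n) \<longlonglongrightarrow> d"
      using tendsto_add[OF tendsto_const LIMSEQ_inverse_real_of_nat] by (simp add: divide_inverse)
  qed (use m dle in \<open>auto intro!: always_eventually less_imp_le\<close>)
  have "Cauchy m"
  proof (rule metric_CauchyI)
    fix e :: real assume e: "0 < e"
    have "(\<lambda>n. 2 * (norm (x - m n))\<^sup>2 - 2 * d\<^sup>2) \<longlonglongrightarrow> 2 * d\<^sup>2 - 2 * d\<^sup>2"
      by (intro tendsto_intros lim)
    \<comment> \<open>The bound in \<open>key\<close> is a sum of two such expressions, one per
      index, hence half of \<open>e\<^sup>2\<close> for each.\<close>
    then have "\<forall>\<^sub>F n in sequentially. 2 * (norm (x - m n))\<^sup>2 - 2 * d\<^sup>2 < e\<^sup>2 / 2"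
      by (rule order_tendstoD(2)) (use e in simp)
    then obtain N where N: "\<And>n. n \<ge> N \<Longrightarrow> 2 * (norm (x - m n))\<^sup>2 - 2 * d\<^sup>2 < e\<^sup>2 / 2"
      by (auto simp: eventually_sequentially)
    have "dist (m a) (m b) < e" if "a \<ge> N" "b \<ge> N" for a b
    proof -
      have "(norm (m a - m b))\<^sup>2 < e\<^sup>2"
        using key[OF m(1) m(1), of a b] N[OF that(1)] N[OF that(2)] by argo
      then show ?thesis using e by (simp add: dist_norm power_less_imp_less_base)
    qed
    then show "\<exists>N. \<forall>a\<ge>N. \<forall>b\<ge>N. dist (m a) (m b) < e" by blast
  qed
  then obtain l where l: "m \<longlonglongrightarrow> l"
    using Cauchy_convergent_iff convergent_def by blast
  have lM: "l \<in> M" using M(2) m(1) l by (meson closed_sequentially)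
  have "(\<lambda>n. norm (x - m n)) \<longlonglongrightarrow> norm (x - l)"
    by (intro tendsto_intros l)
  then have nd: "norm (x - l) = d" using lim LIMSEQ_unique by blast
  have "cinner w (x - l) = 0" if w: "w \<in> M" for w
  proof (cases "w = 0")
    case False
    \<comment> \<open>Moving \<open>l\<close> by \<open>scaleC ?t w\<close> stays in
      \<open>M\<close> and would lower the squared distance by a multiple of the squared modulus of
      \<open>cinner w (x - l)\<close>, which therefore vanishes.\<close>
    let ?t = "cinner w (x - l) / cinner w w"
    have "l + scaleC ?t w \<in> M" using M lM w by (auto simp: csubspace_def)
    from dle[OF this] have "d \<le> norm (x - l - scaleC ?t w)"
      by (simp add: algebra_simps)
    then have "d\<^sup>2 \<le> d\<^sup>2 - (cmod (cinner w (x - l)))\<^sup>2 / (norm w)\<^sup>2"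
      using norm_diff_projection[OF False, of "x - l"] nd d0 power_mono by metis
    then show ?thesis using False by (simp add: divide_le_0_iff)
  qed simp
  then show ?thesis using lM by (auto simp: ortho_compl_def)
qed

text \<open>The residual of \<open>x\<close> after projection is orthogonal both to \<open>x\<close>
  and to the projection, hence to itself. Memberships in closed subspaces are proved below by this
  test.\<close>

lemma ortho_compl_ortho_compl:
  fixes M :: "'a::chilbert set"
  assumes M: "csubspace M" "closed M" and x: "\<And>y. y \<in> ortho_compl M \<Longrightarrow> cinner y x = 0"
  shows "x \<in> M"
proof -
  obtain m where m: "m \<in> M" "x - m \<in> ortho_compl M"
    using orthogonal_decomposition[OF M] by blast
  have "cinner (x - m) x = 0" "cinner m (x - m) = 0"
    using x m by (auto simp: ortho_compl_def)
  then have "cinner (x - m) (x - m) = 0"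
    by (metis cinner_commute cinner_diff_right complex_cnj_zero diff_zero)
  then show ?thesis using m(1) by (simp add: cinner_self_eq_zero)
qed

section \<open>Algebra of bounded complex-linear operators\<close>

lemma cbounded_linear_clinear: "cbounded_linear f \<Longrightarrow> clinear f"
  by (simp add: cbounded_linear_def)

lemma clinear_simps:
  assumes "clinear f"
  shows "f (x + y) = f x + f y" "f (x - y) = f x - f y" "f (scaleC c x) = scaleC c (f x)"
    "f 0 = 0" "f (- x) = - f x"
  using assms clinear_linear[OF assms]
  by (auto simp: clinear_def linear_diff linear_0 linear_neg)

lemma cbounded_linearI:
  "bounded_linear f \<Longrightarrow> (\<And>c x. f (scaleC c x) = scaleC c (f x)) \<Longrightarrow> cbounded_linear f"
  unfolding cbounded_linear_def clinear_def
  by (metis bounded_linear.bounded mult.commute linear_add bounded_linear.linear)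

lemma cbounded_linear_add:
  "cbounded_linear f \<Longrightarrow> cbounded_linear g \<Longrightarrow> cbounded_linear (\<lambda>x. f x + g x)"
  by (rule cbounded_linearI)
     (auto intro!: bounded_linear_add dest: cbounded_linear_bounded_linear
       simp: clinear_simps[OF cbounded_linear_clinear] scaleC_add_right)

lemma cbounded_linear_diff:
  "cbounded_linear f \<Longrightarrow> cbounded_linear g \<Longrightarrow> cbounded_linear (\<lambda>x. f x - g x)"
  by (rule cbounded_linearI)
     (auto intro!: bounded_linear_sub dest: cbounded_linear_bounded_linear
       simp: clinear_simps[OF cbounded_linear_clinear] cvec.scale_right_diff_distrib)

lemma cbounded_linear_compose:
  "cbounded_linear f \<Longrightarrow> cbounded_linear g \<Longrightarrow> cbounded_linear (\<lambda>x. f (g x))"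
  by (rule cbounded_linearI)
     (auto intro!: bounded_linear_compose[of f g] dest: cbounded_linear_bounded_linear
       simp: clinear_simps[OF cbounded_linear_clinear])

lemma cbounded_linear_ident: "cbounded_linear (\<lambda>x. x)"
  by (rule cbounded_linearI) (auto intro: bounded_linear_ident)

lemma cbounded_linear_scaleC: "cbounded_linear (scaleC c)"
  by (rule cbounded_linearI) (auto simp: bounded_linear_scaleC scaleC_scaleC mult.commute)

lemma pythagoras:
  assumes "cinner x y = 0"
  shows "(norm (x + y))\<^sup>2 = (norm x)\<^sup>2 + (norm (y::'a::complex_inner))\<^sup>2"
proof -
  have "cinner y x = 0" using assms by (rule cinner_zero_commute)
  then have "complex_of_real ((norm (x + y))\<^sup>2) = complex_of_real ((norm x)\<^sup>2 + (norm y)\<^sup>2)"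
    unfolding of_real_add cinner_self[symmetric]
    using assms by (simp add: cinner_add_left cinner_add_right)
  then show ?thesis by (simp only: of_real_eq_iff)
qed

definition orth_proj :: "'a::chilbert set \<Rightarrow> 'a \<Rightarrow> 'a" where
  "orth_proj M x = (SOME m. m \<in> M \<and> x - m \<in> ortho_compl M)"

lemma orth_proj:
  assumes "csubspace M" "closed M"
  shows "orth_proj M x \<in> M" "x - orth_proj M x \<in> ortho_compl M"
  using someI_ex[of "\<lambda>m. m \<in> M \<and> x - m \<in> ortho_compl M"] orthogonal_decomposition[OF assms, of x]
  by (auto simp: orth_proj_def)

section \<open>Operators along the forward orbit of a wandering subspace\<close>

text \<open>\<open>V\<close> is the inverse of \<open>U\<close>. Orthogonality of \<open>W\<close>
  to its strictly positive powers already makes all U^n W with n \<ge> 0 mutually orthogonal,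
  because \<open>U\<close> preserves inner products.\<close>

locale wandering =
  fixes U V :: "'a::chilbert \<Rightarrow> 'a" and W :: "'a set"
  assumes U: "cbounded_linear U" and V: "cbounded_linear V"
    and UV [simp]: "U (V x) = x" and VU [simp]: "V (U x) = x"
    and isometric: "cinner (U x) (U y) = cinner x y"
    and W: "csubspace W" "closed W"
    and wander: "x \<in> W \<Longrightarrow> y \<in> W \<Longrightarrow> cinner ((U ^^ Suc n) x) y = 0"
begin

section \<open>Powers of the shift and components along the forward orbit\<close>

lemma cbounded_linear_pow: "cbounded_linear (U ^^ n)" "cbounded_linear (V ^^ n)"
  by (induction n) (auto simp: o_def id_def intro: cbounded_linear_ident cbounded_linear_compose U V)

lemma pow_inverse [simp]: "(U ^^ n) ((V ^^ n) x) = x" "(V ^^ n) ((U ^^ n) x) = x"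
proof -
  show "(V ^^ n) ((U ^^ n) x) = x"
    by (induction n arbitrary: x) (simp_all add: funpow_swap1)
  show "(U ^^ n) ((V ^^ n) x) = x"
    by (induction n arbitrary: x) (simp_all add: funpow_swap1)
qed

lemma isometric_pow: "cinner ((U ^^ n) x) ((U ^^ n) y) = cinner x y"
  by (induction n) (simp_all add: isometric)

lemma norm_pow [simp]: "norm ((U ^^ n) x) = norm x"
  by (simp add: norm_eq_sqrt_cinner isometric_pow)

lemma cinner_pow_V: "cinner ((V ^^ n) x) y = cinner x ((U ^^ n) y)"
  by (metis isometric_pow pow_inverse(1))

lemma cinner_pow_V_right: "cinner x ((V ^^ n) y) = cinner ((U ^^ n) x) y"
  by (metis isometric_pow pow_inverse(1))

lemma orthogonal_pow:
  assumes "x \<in> W" "y \<in> W" "m \<noteq> n"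
  shows "cinner ((U ^^ m) x) ((U ^^ n) y) = 0"
proof -
  have *: "cinner ((U ^^ m) x) ((U ^^ n) y) = 0" if "n < m" "x \<in> W" "y \<in> W" for m n x y
  proof -
    obtain k where k: "m = n + Suc k" using \<open>n < m\<close> less_iff_Suc_add by auto
    show ?thesis unfolding k funpow_add o_def isometric_pow using wander that by blast
  qed
  show ?thesis
  proof (cases "n < m")
    case False
    then have "cinner ((U ^^ n) y) ((U ^^ m) x) = 0" using * assms by simp
    then show ?thesis by (rule cinner_zero_commute)
  qed (use * assms in blast)
qed

text \<open>Moving \<open>V ^^ m\<close> to the other side of the inner product reduces this to
  \<open>orthogonal_pow\<close>. It removes the off-diagonal terms of the series below.\<close>

lemma pow_W_ortho_compl:
  assumes "w \<in> W" "m \<noteq> n"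
  shows "(V ^^ m) ((U ^^ n) w) \<in> ortho_compl W"
  using assms orthogonal_pow by (auto simp: ortho_compl_def cinner_pow_V_right)

lemma norm_sum_pow:
  assumes "finite F" "\<And>k. k \<in> F \<Longrightarrow> a k \<in> W"
  shows "(norm (\<Sum>k\<in>F. (U ^^ k) (a k)))\<^sup>2 = (\<Sum>k\<in>F. (norm (a k))\<^sup>2)"
  using assms
proof (induction F rule: finite_induct)
  case (insert k F)
  have "cinner ((U ^^ k) (a k)) (\<Sum>j\<in>F. (U ^^ j) (a j)) = 0"
    unfolding bounded_bilinear.sum_right[OF bounded_bilinear_cinner]
    using insert by (auto intro!: sum.neutral orthogonal_pow)
  from pythagoras[OF this] insert show ?case by simp
qed simp

text \<open>The component of \<open>x\<close> in U^n W, pulled back to \<open>W\<close>: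
  \<open>(U ^^ n) (coeff x n)\<close> is the orthogonal projection of \<open>x\<close> onto U^n
  W.\<close>

abbreviation coeff :: "'a \<Rightarrow> nat \<Rightarrow> 'a" where
  "coeff x n \<equiv> orth_proj W ((V ^^ n) x)"

text \<open>For finite \<open>F\<close> the partial sum \<open>s\<close> of components is orthogonal
  to \<open>x - s\<close>, so Pythagoras bounds its norm by that of \<open>x\<close>.\<close>

lemma bessel: "summable (\<lambda>n. (norm (coeff x n))\<^sup>2)" "(\<Sum>n. (norm (coeff x n))\<^sup>2) \<le> (norm x)\<^sup>2"
proof -
  have le: "(\<Sum>n\<in>F. (norm (coeff x n))\<^sup>2) \<le> (norm x)\<^sup>2" if "finite F" for F
  proof -
    define s where "s = (\<Sum>n\<in>F. (U ^^ n) (coeff x n))"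
    have s: "(norm s)\<^sup>2 = (\<Sum>n\<in>F. (norm (coeff x n))\<^sup>2)"
      unfolding s_def by (rule norm_sum_pow[OF that]) (simp add: orth_proj W)
    have c: "cinner (coeff x n) ((V ^^ n) x) = cinner (coeff x n) (coeff x n)" for n
      using orth_proj[OF W, of "(V ^^ n) x"]
      by (auto simp: ortho_compl_def cinner_diff_right)
    have "cinner s x = (\<Sum>n\<in>F. cinner ((U ^^ n) (coeff x n)) x)"
      unfolding s_def by (rule bounded_bilinear.sum_left[OF bounded_bilinear_cinner])
    also have "\<dots> = (\<Sum>n\<in>F. complex_of_real ((norm (coeff x n))\<^sup>2))"
      by (simp only: cinner_pow_V_right[symmetric] c cinner_self)
    also have "\<dots> = cinner s s" by (simp add: s cinner_self flip: of_real_power)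
    finally have "cinner s (x - s) = 0" by (simp add: cinner_diff_right)
    from pythagoras[OF this] show ?thesis using s by simp
  qed
  show sm: "summable (\<lambda>n. (norm (coeff x n))\<^sup>2)"
    by (rule bounded_imp_summable[where B = "(norm x)\<^sup>2"]) (auto intro: le)
  show "(\<Sum>n. (norm (coeff x n))\<^sup>2) \<le> (norm x)\<^sup>2"
    using sm by (intro suminf_le_const) (auto intro: le)
qed

section \<open>Block-diagonal operators on the forward orbit\<close>

definition supported :: "('a \<Rightarrow> 'a) \<Rightarrow> bool" where
  "supported A \<longleftrightarrow> cbounded_linear A \<and> (\<forall>x. A x \<in> W) \<and> (\<forall>x\<in>ortho_compl W. A x = 0)"

text \<open>For \<open>supported A\<close> this is the block-diagonal operator that carries a copy
  of \<open>A\<close> on every U^n W with n \<ge> 0 and vanishes on the orthogonal complement of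
  these spaces. The series converges pointwise.\<close>

definition shift_sum :: "('a \<Rightarrow> 'a) \<Rightarrow> 'a \<Rightarrow> 'a" where
  "shift_sum A x = (\<Sum>n. (U ^^ n) (A ((V ^^ n) x)))"

lemma supported_orth_proj:
  assumes "supported A"
  shows "A (orth_proj W x) = A x"
proof -
  have "A (x - orth_proj W x) = 0"
    using assms orth_proj[OF W] by (auto simp: supported_def)
  then show ?thesis
    using assms by (auto simp: supported_def clinear_simps[OF cbounded_linear_clinear])
qed

text \<open>The terms are mutually orthogonal, so their squared norms add, and \<open>A\<close> sees
  only the component in \<open>W\<close>. A single \<open>M\<close> for all \<open>x\<close> and
  \<open>F\<close> serves both the Cauchy criterion and the operator bound.\<close>

lemma supported_bound:
  assumes "supported A"
  shows "\<exists>M>0. \<forall>x F. finite F \<longrightarrow>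
    (norm (\<Sum>n\<in>F. (U ^^ n) (A ((V ^^ n) x))))\<^sup>2 \<le> M\<^sup>2 * (\<Sum>n\<in>F. (norm (coeff x n))\<^sup>2)"
proof -
  have "bounded_linear A" using assms cbounded_linear_bounded_linear by (auto simp: supported_def)
  then obtain M where M: "M > 0" "\<And>x. norm (A x) \<le> M * norm x"
    by (metis bounded_linear.pos_bounded mult.commute)
  have "(norm (\<Sum>n\<in>F. (U ^^ n) (A ((V ^^ n) x))))\<^sup>2 \<le> M\<^sup>2 * (\<Sum>n\<in>F. (norm (coeff x n))\<^sup>2)"
    if F: "finite F" for x F
  proof -
    have "(norm (\<Sum>n\<in>F. (U ^^ n) (A ((V ^^ n) x))))\<^sup>2 = (\<Sum>n\<in>F. (norm (A ((V ^^ n) x)))\<^sup>2)"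
      using assms by (intro norm_sum_pow F) (auto simp: supported_def)
    also have "\<dots> \<le> (\<Sum>n\<in>F. M\<^sup>2 * (norm (coeff x n))\<^sup>2)"
    proof (rule sum_mono)
      fix n
      have "norm (A ((V ^^ n) x)) \<le> M * norm (coeff x n)"
        using M(2)[of "coeff x n"] by (simp add: supported_orth_proj assms)
      from power_mono[OF this norm_ge_zero, of 2]
      show "(norm (A ((V ^^ n) x)))\<^sup>2 \<le> M\<^sup>2 * (norm (coeff x n))\<^sup>2"
        by (simp add: power_mult_distrib)
    qed
    finally show ?thesis by (simp add: sum_distrib_left)
  qed
  then show ?thesis using M(1) by blast
qed

lemma shift_sum_sums:
  assumes A: "supported A"
  shows "(\<lambda>n. (U ^^ n) (A ((V ^^ n) x))) sums shift_sum A x"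
proof -
  obtain M where M: "M > 0"
    "\<And>x F. finite F \<Longrightarrow> (norm (\<Sum>n\<in>F. (U ^^ n) (A ((V ^^ n) x))))\<^sup>2 \<le> M\<^sup>2 * (\<Sum>n\<in>F. (norm (coeff x n))\<^sup>2)"
    using supported_bound[OF A] by blast
  have "summable (\<lambda>n. (U ^^ n) (A ((V ^^ n) x)))"
    unfolding summable_Cauchy
  proof (intro allI impI)
    fix e :: real assume e: "e > 0"
    \<comment> \<open>This tolerance for the Bessel tail becomes \<open>e\<^sup>2\<close> after
      multiplication by \<open>M\<^sup>2\<close>.\<close>
    then have "(e / M)\<^sup>2 > 0" using M by simp
    then obtain N where N: "\<And>m n. m \<ge> N \<Longrightarrow> norm (\<Sum>k=m..<n. (norm (coeff x k))\<^sup>2) < (e / M)\<^sup>2"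
      using bessel(1)[of x] unfolding summable_Cauchy by metis
    have "norm (\<Sum>k=m..<n. (U ^^ k) (A ((V ^^ k) x))) < e" if "m \<ge> N" for m n
    proof -
      have "(norm (\<Sum>k=m..<n. (U ^^ k) (A ((V ^^ k) x))))\<^sup>2 \<le> M\<^sup>2 * (\<Sum>k=m..<n. (norm (coeff x k))\<^sup>2)"
        by (rule M) simp
      also have "\<dots> < M\<^sup>2 * (e / M)\<^sup>2"
        using N[OF that, of n] M(1) by (intro mult_strict_left_mono) auto
      also have "\<dots> = e\<^sup>2" using M(1) by (simp add: power_divide)
      finally show ?thesis using e by (simp add: power_less_imp_less_base)
    qed
    then show "\<exists>N. \<forall>m\<ge>N. \<forall>n. norm (\<Sum>k=m..<n. (U ^^ k) (A ((V ^^ k) x))) < e" by blast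
  qed
  then show ?thesis unfolding shift_sum_def by (rule summable_sums)
qed

lemma cbounded_linear_shift_sum:
  assumes A: "supported A"
  shows "cbounded_linear (shift_sum A)"
proof -
  have cA: "cbounded_linear A" using A by (simp add: supported_def)
  note lin = cA[THEN cbounded_linear_clinear, THEN clinear_simps(1)]
    cA[THEN cbounded_linear_clinear, THEN clinear_simps(3)]
    cbounded_linear_pow[THEN cbounded_linear_clinear, THEN clinear_simps(1)]
    cbounded_linear_pow[THEN cbounded_linear_clinear, THEN clinear_simps(3)]
  have add: "shift_sum A (x + y) = shift_sum A x + shift_sum A y" for x y
    by (rule sums_unique2[OF shift_sum_sums[OF A]])
      (use sums_add[OF shift_sum_sums[OF A, of x] shift_sum_sums[OF A, of y]] in \<open>simp add: lin\<close>)
  have scale: "shift_sum A (scaleC c x) = scaleC c (shift_sum A x)" for c x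
    by (rule sums_unique2[OF shift_sum_sums[OF A]])
      (use bounded_linear.sums[OF bounded_linear_scaleC shift_sum_sums[OF A, of x], of c] in
        \<open>simp add: lin\<close>)
  obtain M where M: "M > 0"
    "\<And>x F. finite F \<Longrightarrow> (norm (\<Sum>n\<in>F. (U ^^ n) (A ((V ^^ n) x))))\<^sup>2 \<le> M\<^sup>2 * (\<Sum>n\<in>F. (norm (coeff x n))\<^sup>2)"
    using supported_bound[OF A] by blast
  have bound: "norm (shift_sum A x) \<le> M * norm x" for x
  proof -
    have "norm (\<Sum>n<N. (U ^^ n) (A ((V ^^ n) x))) \<le> M * norm x" for N
    proof (rule power2_le_imp_le)
      have "(\<Sum>n<N. (norm (coeff x n))\<^sup>2) \<le> (norm x)\<^sup>2"
        using sum_le_suminf[OF bessel(1)[of x], of "{..<N}"] bessel(2)[of x] by simp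
      then have "M\<^sup>2 * (\<Sum>n<N. (norm (coeff x n))\<^sup>2) \<le> (M * norm x)\<^sup>2"
        by (simp add: power_mult_distrib mult_left_mono)
      then show "(norm (\<Sum>n<N. (U ^^ n) (A ((V ^^ n) x))))\<^sup>2 \<le> (M * norm x)\<^sup>2"
        using M(2)[of "{..<N}" x] by simp
    qed (use M in simp)
    moreover have "(\<lambda>N. norm (\<Sum>n<N. (U ^^ n) (A ((V ^^ n) x)))) \<longlonglongrightarrow> norm (shift_sum A x)"
      using shift_sum_sums[OF A, of x] by (intro tendsto_norm) (simp add: sums_def)
    ultimately show ?thesis by (intro LIMSEQ_le_const2) auto
  qed
  show ?thesis unfolding cbounded_linear_def clinear_def using add scale bound by blast
qed

text \<open>\<open>V ^^ m\<close> brings the m-th block to \<open>W\<close> and sends the others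
  into the complement of \<open>W\<close>, where \<open>A'\<close> vanishes. Hence block-diagonal
  operators multiply blockwise.\<close>

lemma supported_pow_shift_sum:
  assumes A: "supported A" and A': "supported A'"
  shows "A' ((V ^^ m) (shift_sum A x)) = A' (A ((V ^^ m) x))"
proof -
  have bl: "bounded_linear (\<lambda>y. A' ((V ^^ m) y))"
    using A' cbounded_linear_compose[OF _ cbounded_linear_pow(2)]
    by (auto simp: supported_def intro: cbounded_linear_bounded_linear)
  have "A' ((V ^^ m) ((U ^^ n) (A ((V ^^ n) x)))) = (if n = m then A' (A ((V ^^ m) x)) else 0)" for n
  proof (cases "n = m")
    case False
    then have "(V ^^ m) ((U ^^ n) (A ((V ^^ n) x))) \<in> ortho_compl W"
      using A by (intro pow_W_ortho_compl) (auto simp: supported_def)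
    then show ?thesis using A' False by (simp add: supported_def)
  qed simp
  then have "(\<lambda>n. if n = m then A' (A ((V ^^ m) x)) else 0) sums A' ((V ^^ m) (shift_sum A x))"
    using bounded_linear.sums[OF bl shift_sum_sums[OF A, of x]] by simp
  from sums_unique2[OF this sums_single] show ?thesis .
qed

lemma cinner_shift_sum:
  assumes A: "supported A"
  shows "(\<lambda>n. cinner (A ((V ^^ n) x)) ((V ^^ n) y)) sums cinner (shift_sum A x) y"
    "(\<lambda>n. cinner ((V ^^ n) y) (A ((V ^^ n) x))) sums cinner y (shift_sum A x)"
proof -
  show "(\<lambda>n. cinner (A ((V ^^ n) x)) ((V ^^ n) y)) sums cinner (shift_sum A x) y"
    using bounded_linear.sums[OF bounded_bilinear.bounded_linear_left[OF bounded_bilinear_cinner] shift_sum_sums[OF A]]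
    by (simp add: cinner_pow_V_right)
  show "(\<lambda>n. cinner ((V ^^ n) y) (A ((V ^^ n) x))) sums cinner y (shift_sum A x)"
    using bounded_linear.sums[OF bounded_bilinear.bounded_linear_right[OF bounded_bilinear_cinner] shift_sum_sums[OF A]]
    by (simp add: cinner_pow_V)
qed

text \<open>Applying \<open>U\<close> to the series for \<open>x\<close> gives the tail n \<ge> 1 of
  the series for \<open>U x\<close>; the missing term n = 0 is the failure to commute with
  \<open>U\<close>.\<close>

lemma shift_sum_U:
  assumes A: "supported A"
  shows "shift_sum A (U x) = A (U x) + U (shift_sum A x)"
proof -
  have "(\<lambda>n. U ((U ^^ n) (A ((V ^^ n) x)))) sums U (shift_sum A x)"
    by (rule bounded_linear.sums[OF cbounded_linear_bounded_linear[OF U] shift_sum_sums[OF A]])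
  then have "(\<lambda>n. (U ^^ Suc n) (A ((V ^^ Suc n) (U x)))) sums U (shift_sum A x)"
    by (simp add: funpow_swap1)
  from sums_Suc[OF this]
  have "(\<lambda>n. (U ^^ n) (A ((V ^^ n) (U x)))) sums (A (U x) + U (shift_sum A x))"
    by (simp add: add.commute)
  with shift_sum_sums[OF A, of "U x"] show ?thesis by (rule sums_unique2)
qed

end

section \<open>The symmetry built from the Cayley transform\<close>

locale phillips_cayley = wandering U V "U ` W0" for U V :: "'a::chilbert \<Rightarrow> 'a" and W0 +
  fixes J K L :: "'a \<Rightarrow> 'a"
  assumes W0: "csubspace W0" "closed W0"
    and J: "cbounded_linear J" and J_sym: "cinner (J x) y = cinner x (J y)" and JJ [simp]: "J (J x) = x"
    and J_perp: "x \<in> ortho_compl W0 \<Longrightarrow> J x \<in> ortho_compl W0"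
    and J_U: "x \<in> ortho_compl W0 \<Longrightarrow> J (U x) = U (J x)"
    and K: "cbounded_linear K" and L: "cbounded_linear L"
    and KL [simp]: "K (L x) = x" and LK [simp]: "L (K x) = x"
    and K_perp: "x \<in> ortho_compl W0 \<Longrightarrow> K x = U x"
    and V_K: "V (K x) - x \<in> W0"
    and K_form: "cinner (K x) (J (K y)) = cinner x (J y)"
begin

lemmas lin = clinear_simps[OF cbounded_linear_clinear]
lemmas J_lin = lin[OF J] and K_lin = lin[OF K] and L_lin = lin[OF L] and U_lin = lin[OF U]

section \<open>Invariance of \<open>W0\<close> and its image under \<open>J\<close>,
  \<open>K\<close> and \<open>L\<close>\<close>

lemma perp_U: "x \<in> ortho_compl W0 \<Longrightarrow> U x \<in> ortho_compl (U ` W0)"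
  by (auto simp: ortho_compl_def isometric)

lemma perp_V:
  assumes "x \<in> ortho_compl (U ` W0)"
  shows "V x \<in> ortho_compl W0"
proof -
  have "cinner w (V x) = 0" if "w \<in> W0" for w
    using assms that isometric[of w "V x"] by (simp add: ortho_compl_def)
  then show ?thesis by (simp add: ortho_compl_def)
qed

text \<open>The case n = 0 is included because \<open>w\<close> already lies one shift beyond
  \<open>W0\<close>.\<close>

lemma pow_perp:
  assumes "w \<in> U ` W0"
  shows "(U ^^ n) w \<in> ortho_compl W0"
proof -
  have "cinner v ((U ^^ n) w) = 0" if "v \<in> W0" for v
  proof (rule cinner_zero_commute)
    show "cinner ((U ^^ n) w) v = 0"
      using wander[OF assms, of "U v" n] that by (simp add: isometric)
  qed
  then show ?thesis by (simp add: ortho_compl_def)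
qed

lemma cinner_J_perp: "J y \<in> ortho_compl M \<Longrightarrow> w \<in> M \<Longrightarrow> cinner y (J w) = 0"
  unfolding J_sym[symmetric] by (rule cinner_zero_commute) (simp add: ortho_compl_def)

text \<open>A symmetric operator that preserves a subspace preserves its orthogonal
  complement.\<close>

lemma J_W0: "w \<in> W0 \<Longrightarrow> J w \<in> W0"
  by (rule ortho_compl_ortho_compl[OF W0]) (rule cinner_J_perp[OF J_perp])

text \<open>On the complement of U W0, \<open>J\<close> equals U J V and so preserves that
  complement; symmetry transfers this to U W0.\<close>

lemma J_W:
  assumes "w \<in> U ` W0"
  shows "J w \<in> U ` W0"
proof (rule ortho_compl_ortho_compl[OF W])
  fix y assume y: "y \<in> ortho_compl (U ` W0)"
  have "J y = U (J (V y))" using J_U[OF perp_V[OF y]] by simp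
  then have "J y \<in> ortho_compl (U ` W0)" using perp_U J_perp perp_V[OF y] by simp
  then show "cinner y (J w) = 0" using assms by (rule cinner_J_perp)
qed

lemma J_pow: "w \<in> U ` W0 \<Longrightarrow> J ((U ^^ n) w) = (U ^^ n) (J w)"
  by (induction n) (auto simp: J_U pow_perp)

lemma K_W0:
  assumes "w \<in> W0"
  shows "K w \<in> U ` W0"
proof -
  have "V (K w) - w + w \<in> W0" using V_K assms W0 unfolding csubspace_def by blast
  then have "V (K w) \<in> W0" by simp
  then show ?thesis by (metis UV imageI)
qed

lemma L_W:
  assumes "x \<in> U ` W0"
  shows "L x \<in> W0"
proof -
  have "V x \<in> W0" using assms by auto
  moreover have "V x - L x \<in> W0" using V_K[of "L x"] by simp
  ultimately have "V x - (V x - L x) \<in> W0" using W0(1) csubspace_diff by blast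
  then show ?thesis by simp
qed

text \<open>The operator Y of the outline: the change in \<open>J\<close> under conjugation by
  \<open>K\<close>.\<close>

definition jump :: "'a \<Rightarrow> 'a" where
  "jump x = K (J (L x)) - J x"

text \<open>Here \<open>L\<close> acts as \<open>V\<close> and \<open>K\<close> as \<open>U\<close>,
  so K J L reduces to U J V, which is \<open>J\<close> on this complement.\<close>

lemma jump_perp:
  assumes "x \<in> ortho_compl (U ` W0)"
  shows "jump x = 0"
proof -
  have v: "V x \<in> ortho_compl W0" using perp_V[OF assms] .
  have "L x = V x" using K_perp[OF v] LK[of "V x"] by simp
  then have "K (J (L x)) = U (J (V x))" using K_perp[OF J_perp[OF v]] by simp
  also have "\<dots> = J x" using J_U[OF v] by simp
  finally show ?thesis by (simp add: jump_def)
qed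

lemma cbounded_linear_jump: "cbounded_linear jump"
  unfolding jump_def[abs_def]
  by (rule cbounded_linear_diff[OF cbounded_linear_compose[OF K cbounded_linear_compose[OF J L]] J])

lemmas jump_lin = lin[OF cbounded_linear_jump]

text \<open>Only the component in U W0 matters by \<open>jump_perp\<close>, and \<open>L\<close>,
  \<open>J\<close>, \<open>K\<close> carry it through \<open>W0\<close> back to U W0.\<close>

lemma jump_W: "jump x \<in> U ` W0"
proof -
  let ?m = "orth_proj (U ` W0) x"
  have m: "?m \<in> U ` W0" "x - ?m \<in> ortho_compl (U ` W0)" using orth_proj[OF W] by auto
  have "jump x = jump ?m" using jump_perp[OF m(2)] by (simp add: jump_lin)
  moreover have "K (J (L ?m)) \<in> U ` W0"
    using m(1) L_W J_W0 K_W0 by auto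
  ultimately show ?thesis unfolding jump_def
    using J_W[OF m(1)] csubspace_diff[OF W(1)] by simp
qed

lemma supported_jump: "supported jump"
  by (simp add: supported_def cbounded_linear_jump jump_W jump_perp)

lemma supported_J_jump: "supported (\<lambda>x. J (jump x))"
  by (simp add: supported_def cbounded_linear_compose[OF J cbounded_linear_jump] jump_W jump_perp
      J_W J_lin)

text \<open>\<open>K_form\<close> turns J K J L into L^* L. Thus J Y is L^* L - I, which is
  symmetric and bounded below by -I.\<close>

lemma cinner_J_jump: "cinner (J (jump x)) y = cinner (L x) (L y) - cinner x y"
proof -
  have "cinner (J (K (J (L x)))) y = cinner (L x) (L y)"
    using K_form[of "J (L x)" "L y"] by (simp add: J_sym)
  then show ?thesis by (simp add: jump_def J_lin cinner_diff_left)
qed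

text \<open>
  \<open>stable_C\<close> is \<open>J\<close> on \<open>U^n W0\<close> for \<open>n \<le> 0\<close> and \<open>U^n J\<^sub>1 U^-n\<close> for \<open>n \<ge> 1\<close>, where \<open>J\<^sub>1\<close> is the
  compression of \<open>U^-1 (K J L) U\<close> to \<open>W0\<close>.
\<close>
definition stable_C :: "'a \<Rightarrow> 'a" where
  "stable_C x = J x + shift_sum jump x"

lemma cbounded_linear_stable_C: "cbounded_linear stable_C"
  unfolding stable_C_def[abs_def]
  by (rule cbounded_linear_add[OF J cbounded_linear_shift_sum[OF supported_jump]])

section \<open>Involution and positivity of \<open>stable_C\<close>\<close>

lemma J_shift_sum_sums:
  "(\<lambda>n. (U ^^ n) (J (jump ((V ^^ n) x)))) sums J (shift_sum jump x)"
  using bounded_linear.sums[OF cbounded_linear_bounded_linear[OF J] shift_sum_sums[OF supported_jump]]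
  by (simp add: J_pow jump_W)

text \<open>\<open>J\<close> commutes with the powers of \<open>U\<close> on U W0, so the two
  arguments differ by a vector orthogonal to U W0, which \<open>jump\<close> ignores.\<close>

lemma jump_pow_J: "jump ((V ^^ n) (J x)) = jump (J ((V ^^ n) x))"
proof -
  have "cinner w ((V ^^ n) (J x) - J ((V ^^ n) x)) = 0" if w: "w \<in> U ` W0" for w
    using J_pow[OF w, of n] by (simp add: cinner_diff_right cinner_pow_V_right J_sym[symmetric])
  then have "jump ((V ^^ n) (J x) - J ((V ^^ n) x)) = 0"
    by (intro jump_perp) (simp add: ortho_compl_def)
  then show ?thesis by (simp add: jump_lin)
qed

lemma stable_C_involution: "stable_C (stable_C x) = x"
proof -
  let ?D = "shift_sum jump"
  \<comment> \<open>K J L is conjugate to \<open>J\<close>, so J + Y squares to the identity. Its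
    expansion is then transported to each block and summed.\<close>
  have "J (jump z) + jump (J z) + jump (jump z) = 0" for z
  proof -
    have "K (J (L (K (J (L z))))) = z" by simp
    then have "jump (jump z + J z) + J (jump z + J z) = z" by (simp add: jump_def)
    then show ?thesis by (simp add: jump_lin J_lin algebra_simps)
  qed
  then have "(U ^^ n) (J (jump z)) + (U ^^ n) (jump (J z)) + (U ^^ n) (jump (jump z)) = 0" for n z
    by (simp flip: lin(1)[OF cbounded_linear_pow(1)] add: lin(4)[OF cbounded_linear_pow(1)])
  moreover have "(\<lambda>n. (U ^^ n) (jump (J ((V ^^ n) x)))) sums ?D (J x)"
    using shift_sum_sums[OF supported_jump, of "J x"] by (simp add: jump_pow_J)
  moreover have "(\<lambda>n. (U ^^ n) (jump (jump ((V ^^ n) x)))) sums ?D (?D x)"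
    using shift_sum_sums[OF supported_jump, of "?D x"]
    by (simp add: supported_pow_shift_sum[OF supported_jump supported_jump])
  ultimately have "(\<lambda>n. 0) sums (J (?D x) + ?D (J x) + ?D (?D x))"
    using sums_add[OF sums_add[OF J_shift_sum_sums[of x]],
        of "\<lambda>n. (U ^^ n) (jump (J ((V ^^ n) x)))" _ "\<lambda>n. (U ^^ n) (jump (jump ((V ^^ n) x)))"]
    by simp
  from sums_unique2[OF this sums_zero] have "J (?D x) + ?D (J x) + ?D (?D x) = 0" .
  then show ?thesis
    by (simp add: stable_C_def J_lin lin[OF cbounded_linear_shift_sum[OF supported_jump]] add.assoc)
qed

lemma J_shift_sum: "J (shift_sum jump x) = shift_sum (\<lambda>x. J (jump x)) x"
  by (rule sums_unique2[OF J_shift_sum_sums shift_sum_sums[OF supported_J_jump]])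

lemma cinner_J_stable_C: "cinner (J (stable_C x)) y = cinner x (J (stable_C y))"
proof -
  have "cinner (J (jump u)) v = cinner u (J (jump v))" for u v
    by (simp add: cinner_commute[of u "J (jump v)"] cinner_J_jump
        cinner_commute[of "L u" "L v"] cinner_commute[of u v])
  then have "cinner (J (shift_sum jump x)) y = cinner x (J (shift_sum jump y))"
    unfolding J_shift_sum
    by (intro sums_unique2[OF cinner_shift_sum(1)[OF supported_J_jump]])
      (use cinner_shift_sum(2)[OF supported_J_jump, where x = y and y = x] in simp)
  then show ?thesis by (simp add: stable_C_def J_lin cinner_add_left cinner_add_right)
qed

text \<open>The form equals the squared norm of \<open>x\<close> plus the sum of |L m_n|^2 -
  |m_n|^2, and Bessel absorbs the negative part. If the total were not positive, all L m_n would
  vanish, hence all m_n since \<open>L\<close> is injective, and then \<open>x\<close>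
  itself.\<close>

lemma J_stable_C_positive:
  assumes "x \<noteq> 0"
  shows "0 < Re (cinner (J (stable_C x)) x)"
proof -
  define m where "m = coeff x"
  have "cinner (J (jump ((V ^^ n) x))) ((V ^^ n) x)
    = complex_of_real ((norm (L (m n)))\<^sup>2 - (norm (m n))\<^sup>2)" for n
  proof -
    let ?z = "(V ^^ n) x"
    have "cinner (J (jump ?z)) (?z - m n) = 0"
      using orth_proj[OF W, of ?z] J_W[OF jump_W[of ?z]] by (auto simp: ortho_compl_def m_def)
    then have "cinner (J (jump ?z)) ?z = cinner (J (jump ?z)) (m n)"
      by (simp add: cinner_diff_right)
    also have "\<dots> = cinner (J (jump (m n))) (m n)"
      by (simp add: m_def supported_orth_proj supported_jump)
    finally show ?thesis by (simp only: cinner_J_jump cinner_self of_real_diff)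
  qed
  then have s: "(\<lambda>n. complex_of_real ((norm (L (m n)))\<^sup>2 - (norm (m n))\<^sup>2)) sums cinner (J (shift_sum jump x)) x"
    using cinner_shift_sum(1)[OF supported_J_jump, of x x] by (simp only: J_shift_sum)
  define r where "r = Re (cinner (J (shift_sum jump x)) x)"
  have r: "(\<lambda>n. (norm (L (m n)))\<^sup>2 - (norm (m n))\<^sup>2) sums r"
    using sums_Re[OF s] by (simp only: Re_complex_of_real r_def)
  define b where "b = (\<Sum>n. (norm (m n))\<^sup>2)"
  have b: "(\<lambda>n. (norm (m n))\<^sup>2) sums b" "b \<le> (norm x)\<^sup>2"
    unfolding b_def m_def using bessel[of x] by (auto intro: summable_sums)
  have rb: "(\<lambda>n. (norm (L (m n)))\<^sup>2) sums (r + b)"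
    using sums_add[OF r b(1)] by simp
  have eq: "Re (cinner (J (stable_C x)) x) = (norm x)\<^sup>2 + r"
    by (simp add: stable_C_def J_lin cinner_add_left cinner_self r_def)
  have nn: "r + b \<ge> 0" using sums_le[OF _ sums_zero rb] by simp
  show ?thesis
  proof (rule ccontr)
    assume "\<not> ?thesis"
    then have le: "(norm x)\<^sup>2 + r \<le> 0" using eq by simp
    then have "r + b = 0" using nn b(2) by simp
    then have "(norm (L (m n)))\<^sup>2 = 0" for n
      using suminf_eq_zero_iff[of "\<lambda>n. (norm (L (m n)))\<^sup>2"] rb by (auto simp: sums_iff)
    then have "m n = 0" for n using KL[of "m n"] by (simp add: K_lin)
    then have "r = 0" using r sums_unique2[OF _ sums_zero] by (simp add: L_lin)
    then show False using le assms by simp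
  qed
qed

lemma positive_J_stable_C: "positive_op (J \<circ> stable_C)"
proof -
  have "Im (cinner (J (stable_C x)) x) = 0" for x
    using arg_cong[OF trans[OF cinner_J_stable_C[of x x] cinner_commute], of Im] by simp
  then show ?thesis
    unfolding positive_op_def
    using cbounded_linear_compose[OF J cbounded_linear_stable_C] cinner_J_stable_C J_stable_C_positive
    by (simp add: o_def)
qed

section \<open>Commutation with the restricted shift and with \<open>K\<close>\<close>

lemma shift_sum_perp: "shift_sum jump x \<in> ortho_compl W0"
proof -
  have "cinner w (shift_sum jump x) = 0" if w: "w \<in> W0" for w
  proof -
    have "(\<lambda>n. cinner w ((U ^^ n) (jump ((V ^^ n) x)))) sums cinner w (shift_sum jump x)"
      by (rule bounded_linear.sums[OF bounded_bilinear.bounded_linear_right[OF bounded_bilinear_cinner]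
            shift_sum_sums[OF supported_jump]])
    moreover have "cinner w ((U ^^ n) (jump ((V ^^ n) x))) = 0" for n
      using pow_perp[OF jump_W] w by (auto simp: ortho_compl_def)
    ultimately show ?thesis using sums_unique2[OF _ sums_zero] by simp
  qed
  then show ?thesis by (simp add: ortho_compl_def)
qed

lemma stable_C_perp:
  assumes "x \<in> ortho_compl W0"
  shows "stable_C x \<in> ortho_compl W0"
  using J_perp[OF assms] shift_sum_perp[of x]
  by (auto simp: stable_C_def ortho_compl_def cinner_add_right)

text \<open>The extra term in \<open>shift_sum_U\<close> is \<open>jump (U x)\<close>, and
  \<open>U x\<close> is orthogonal to U W0.\<close>

lemma stable_C_U:
  assumes "x \<in> ortho_compl W0"
  shows "stable_C (U x) = U (stable_C x)"
  using assms by (simp add: stable_C_def shift_sum_U[OF supported_jump] J_U jump_perp[OF perp_U] U_lin)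

text \<open>\<open>W0\<close> is orthogonal to every block U^(n+1) W0 on which the sum acts.\<close>

lemma shift_sum_W0:
  assumes "w \<in> W0"
  shows "shift_sum jump w = 0"
proof -
  have "jump ((V ^^ n) w) = 0" for n
  proof (rule jump_perp)
    have "cinner v ((V ^^ n) w) = 0" if "v \<in> U ` W0" for v
      unfolding cinner_pow_V_right
      by (rule cinner_zero_commute) (use pow_perp[OF that, of n] assms in \<open>simp add: ortho_compl_def\<close>)
    then show "(V ^^ n) w \<in> ortho_compl (U ` W0)" by (simp add: ortho_compl_def)
  qed
  then show ?thesis
    by (simp add: shift_sum_def lin[OF cbounded_linear_pow(1)])
qed

text \<open>\<open>V (K x)\<close> and \<open>x\<close> differ by a vector of \<open>W0\<close>,
  which the sum kills, so \<open>shift_sum_U\<close> can be applied at \<open>V (K x)\<close>. The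
  sum takes values where \<open>K\<close> is \<open>U\<close>, and the term
  \<open>jump (K x)\<close> is exactly the commutator of \<open>K\<close> and \<open>J\<close> at
  \<open>x\<close>.\<close>

lemma stable_C_K: "stable_C (K x) = K (stable_C x)"
proof -
  let ?D = "shift_sum jump"
  have "?D (V (K x)) = ?D (x + (V (K x) - x))" by simp
  also have "\<dots> = ?D x"
    by (simp only: lin(1)[OF cbounded_linear_shift_sum[OF supported_jump]] shift_sum_W0[OF V_K]) simp
  finally have "?D (K x) = jump (K x) + U (?D x)"
    using shift_sum_U[OF supported_jump, of "V (K x)"] by simp
  also have "\<dots> = K (J x) - J (K x) + K (?D x)"
    by (simp add: jump_def K_perp[OF shift_sum_perp])
  finally show ?thesis by (simp add: stable_C_def K_lin)
qed

end

section \<open>Spectra of J-self-adjoint extensions\<close>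

lemma is_operator_diff:
  assumes "is_operator T" "(x, y) \<in> T" "(x', y') \<in> T"
  shows "(x - x', y - y') \<in> T"
proof -
  have "(scaleC (- 1) x', scaleC (- 1) y') \<in> T" using assms unfolding is_operator_def by blast
  then have "(x + scaleC (- 1) x', y + scaleC (- 1) y') \<in> T"
    using assms unfolding is_operator_def by blast
  then show ?thesis by simp
qed

lemma is_operator_single_valued:
  assumes T: "is_operator T"
  shows "single_valued T"
proof (rule single_valuedI)
  fix x y z assume "(x, y) \<in> T" "(x, z) \<in> T"
  then have "(0, y - z) \<in> T" using is_operator_diff[OF T, of x y x z] by simp
  then have "y - z = 0" using T unfolding is_operator_def by blast
  then show "y = z" by simp
qed

lemma app_eq: "single_valued T \<Longrightarrow> (x, y) \<in> T \<Longrightarrow> app T x = y"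
  unfolding app_def by (rule the_equality) (auto dest: single_valuedD)

text \<open>Replaces the description through \<open>app\<close> by invariance of the graph, the form
  used in all later arguments.\<close>

lemma commutes_iff:
  assumes "single_valued T"
  shows "commutes T C \<longleftrightarrow> (\<forall>(x, y)\<in>T. (C x, C y) \<in> T)"
proof
  assume c: "commutes T C"
  have "(C x, C y) \<in> T" if "(x, y) \<in> T" for x y
  proof -
    obtain z where z: "(C x, z) \<in> T" using c \<open>(x, y) \<in> T\<close> by (auto simp: commutes_def)
    have "app T (C x) = C (app T x)" using c \<open>(x, y) \<in> T\<close> by (auto simp: commutes_def)
    then show ?thesis using z app_eq[OF assms] that by simp
  qed
  then show "\<forall>(x, y)\<in>T. (C x, C y) \<in> T" by auto
next
  assume "\<forall>(x, y)\<in>T. (C x, C y) \<in> T"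
  then have c: "(C x, C y) \<in> T" if "(x, y) \<in> T" for x y using that by blast
  show "commutes T C"
    unfolding commutes_def
  proof
    fix u assume "u \<in> Domain T"
    then obtain v where "(u, v) \<in> T" by blast
    then show "C u \<in> Domain T \<and> app T (C u) = C (app T u)"
      using c app_eq[OF assms] by (metis Domain.DomainI)
  qed
qed

lemma resolvent_setI:
  assumes T: "single_valued T"
    and inj: "\<And>u v u' v'. (u, v) \<in> T \<Longrightarrow> (u', v') \<in> T \<Longrightarrow> v - scaleC l u = v' - scaleC l u' \<Longrightarrow> u = u'"
    and surj: "\<And>y. \<exists>u v. (u, v) \<in> T \<and> v - scaleC l u = y"
    and bound: "\<And>u v. (u, v) \<in> T \<Longrightarrow> norm u \<le> K * norm (v - scaleC l u)"
  shows "l \<in> resolvent_set T"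
  unfolding resolvent_set_def
proof (intro CollectI conjI allI exI[of _ K] ballI)
  fix y
  obtain u v where uv: "(u, v) \<in> T" "v - scaleC l u = y" using surj by blast
  then show "\<exists>!x. x \<in> Domain T \<and> app T x - scaleC l x = y"
    using inj app_eq[OF T] by (intro ex1I[of _ u]) auto
next
  fix x assume "x \<in> Domain T"
  then show "norm x \<le> K * norm (app T x - scaleC l x)"
    using bound app_eq[OF T] by auto
qed

text \<open>Linearity of the resolvent \<open>R\<close> comes from uniqueness of solutions: sums and
  multiples of graph pairs solve the combined equations.\<close>

lemma resolvent_exists:
  fixes T :: "'a::complex_inner operator"
  assumes T: "is_operator T" and l: "l \<in> resolvent_set T"
  shows "\<exists>R. cbounded_linear R \<and> (\<forall>y. (R y, y + scaleC l (R y)) \<in> T) \<and>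
    (\<forall>u v. (u, v) \<in> T \<longrightarrow> R (v - scaleC l u) = u)"
proof -
  note sv = is_operator_single_valued[OF T]
  have ex: "\<exists>!x. x \<in> Domain T \<and> app T x - scaleC l x = y" for y
    using l by (simp add: resolvent_set_def)
  obtain K where K: "\<And>x. x \<in> Domain T \<Longrightarrow> norm x \<le> K * norm (app T x - scaleC l x)"
    using l unfolding resolvent_set_def by blast
  define R where "R y = (THE x. x \<in> Domain T \<and> app T x - scaleC l x = y)" for y
  have R: "R y \<in> Domain T" "app T (R y) - scaleC l (R y) = y" for y
    using theI'[OF ex[of y]] by (auto simp: R_def)
  have R1: "(R y, y + scaleC l (R y)) \<in> T" for y
  proof -
    obtain v where v: "(R y, v) \<in> T" using R(1) by blast
    then have "v = y + scaleC l (R y)" using R(2)[of y] app_eq[OF sv v] by (simp add: algebra_simps)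
    then show ?thesis using v by simp
  qed
  have R2: "R (v - scaleC l u) = u" if "(u, v) \<in> T" for u v
    using ex[of "v - scaleC l u"] R[of "v - scaleC l u"] that app_eq[OF sv that] by (metis Domain.DomainI)
  have "R (x + y) = R x + R y" for x y
  proof -
    have "(R x + R y, x + scaleC l (R x) + (y + scaleC l (R y))) \<in> T"
      using T R1 unfolding is_operator_def by blast
    from R2[OF this] show ?thesis by (simp add: scaleC_add_right algebra_simps)
  qed
  moreover have "R (scaleC c x) = scaleC c (R x)" for c x
  proof -
    have "(scaleC c (R x), scaleC c (x + scaleC l (R x))) \<in> T"
      using T R1 unfolding is_operator_def by blast
    from R2[OF this] show ?thesis by (simp add: scaleC_add_right scaleC_scaleC mult.commute)
  qed
  moreover have "norm (R x) \<le> K * norm x" for x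
    using K[OF R(1)[of x]] R(2)[of x] by simp
  ultimately have "cbounded_linear R" unfolding cbounded_linear_def clinear_def by blast
  then show ?thesis using R1 R2 by blast
qed

lemma J_selfadjoint_form:
  assumes "J_selfadjoint J B" "(u, v) \<in> B" "(u', v') \<in> B"
  shows "cinner v' (J u) = cinner u' (J v)"
proof -
  have "(u, J v) \<in> {(u, v). (J u, v) \<in> adjoint B}"
    using assms by (auto simp: J_selfadjoint_def)
  then show ?thesis using assms(3) by (auto simp: adjoint_def)
qed

text \<open>The inclusion of B^* J in J B: a pair that passes the symmetry test against all of
  \<open>B\<close> belongs to \<open>B\<close>. It serves to show that \<open>B\<close> is closed
  and to find eigenvectors.\<close>

lemma J_selfadjoint_maximal:
  assumes "J_selfadjoint J B" "fundamental_symmetry J"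
    and "\<And>u' v'. (u', v') \<in> B \<Longrightarrow> cinner v' (J u) = cinner u' w"
  shows "(u, J w) \<in> B"
proof -
  have "(u, w) \<in> {(u, v). (J u, v) \<in> adjoint B}"
    using assms(3) by (auto simp: adjoint_def)
  then have "(u, w) \<in> {(u, J w) | u w. (u, w) \<in> B}"
    using assms(1) by (simp only: J_selfadjoint_def)
  then show ?thesis using assms(2) by (auto simp: fundamental_symmetry_def)
qed

lemma fundamental_symmetry_simps:
  assumes "fundamental_symmetry J"
  shows "cbounded_linear J" "cinner (J x) y = cinner x (J y)" "J (J x) = x"
  using assms by (auto simp: fundamental_symmetry_def)

text \<open>Nonnegativity of the form of \<open>G\<close> at x - H x / M, where \<open>M\<close>
  bounds \<open>H\<close>, gives the estimate: the cross terms contribute -2 |x|^2 / M and the last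
  term at most |x|^2 / M.\<close>

lemma positive_op_coercive:
  fixes G :: "'a::complex_inner \<Rightarrow> 'a"
  assumes G: "positive_op G" and H: "cbounded_linear H" and GH: "\<And>x. G (H x) = x"
  shows "\<exists>M>0. \<forall>x. (norm x)\<^sup>2 \<le> M * Re (cinner x (G x))"
proof -
  have lin: "clinear G" using G by (simp add: positive_op_def cbounded_linear_def)
  have sym: "cinner (G x) y = cinner x (G y)" for x y using G by (simp add: positive_op_def)
  have nonneg: "0 \<le> Re (cinner x (G x))" for x
    using G by (cases "x = 0") (auto simp: positive_op_def sym dest!: spec[of _ x])
  obtain M where M: "M > 0" "\<And>x. norm (H x) \<le> M * norm x"
    using cbounded_linear_bounded_linear[OF H] by (metis bounded_linear.pos_bounded mult.commute)
  have "(norm x)\<^sup>2 \<le> M * Re (cinner x (G x))" for x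
  proof -
    let ?t = "complex_of_real (1 / M)"
    let ?h = "scaleC ?t (H x)"
    have Gh: "G ?h = scaleC ?t x" by (simp add: clinear_simps[OF lin] GH)
    have xh: "cinner x (G ?h) = ?t * complex_of_real ((norm x)\<^sup>2)"
      by (simp only: Gh cinner_scaleC_right cinner_self)
    have hx: "cinner ?h (G x) = ?t * complex_of_real ((norm x)\<^sup>2)"
      using xh by (metis sym Gh cinner_scaleC_left cinner_self complex_cnj_complex_of_real)
    have "Re (cinner (H x) x) \<le> norm (H x) * norm x"
      using norm_cinner_le[of "H x" x] complex_Re_le_cmod order_trans by blast
    also have "\<dots> \<le> M * norm x * norm x" by (rule mult_right_mono[OF M(2)]) simp
    finally have hh: "Re (cinner ?h (G ?h)) \<le> (1 / M)\<^sup>2 * (M * (norm x)\<^sup>2)"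
      unfolding Gh cinner_scaleC_left cinner_scaleC_right using M(1)
      by (simp add: power2_eq_square field_simps)
    have "0 \<le> Re (cinner (x - ?h) (G (x - ?h)))" by (rule nonneg)
    also have "\<dots> = Re (cinner x (G x)) - 2 * ((norm x)\<^sup>2 / M) + Re (cinner ?h (G ?h))"
      unfolding clinear_simps[OF lin] cinner_diff_left cinner_diff_right
      using xh hx by (simp add: clinear_simps[OF lin])
    also have "\<dots> \<le> Re (cinner x (G x)) - 2 * ((norm x)\<^sup>2 / M) + (norm x)\<^sup>2 / M"
      using hh M(1) by (simp add: power2_eq_square)
    finally show ?thesis using M(1) by (simp add: field_simps)
  qed
  with M(1) show ?thesis by blast
qed

text \<open>In the inner product given by G = J C the operator \<open>B\<close> is symmetric, which
  bounds B - k from below for nonreal k. The range of B - l is then closed, and a vector orthogonal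
  to it would produce an eigenvector for the conjugate of \<open>l\<close>.\<close>

lemma C_symmetry_imp_real_spectrum:
  fixes J :: "'a::chilbert \<Rightarrow> 'a"
  assumes J: "fundamental_symmetry J" and B: "J_selfadjoint J B"
    and C: "cbounded_linear C" "\<And>x. C (C x) = x" and pos: "positive_op (J \<circ> C)"
    and comm: "commutes B C" and l: "Im l \<noteq> 0"
  shows "l \<in> resolvent_set B"
proof -
  note JS = fundamental_symmetry_simps[OF J]
  have op: "is_operator B" using B by (simp add: J_selfadjoint_def)
  note sv = is_operator_single_valued[OF op]
  define G where "G x = J (C x)" for x
  have G: "positive_op G" using pos by (simp add: G_def[abs_def] o_def)
  have Glin: "cbounded_linear G" and Gsym: "cinner (G x) y = cinner x (G y)" for x y
    using G by (auto simp: positive_op_def)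
  note Gl = clinear_simps[OF cbounded_linear_clinear[OF Glin]]
  note Gb = cbounded_linear_bounded_linear[OF Glin]
  \<comment> \<open>C J is a bounded inverse of G = J C, so \<open>G\<close> is coercive.\<close>
  obtain M where M: "M > 0" "\<And>x. (norm x)\<^sup>2 \<le> M * Re (cinner x (G x))"
    using positive_op_coercive[OF G cbounded_linear_compose[OF C(1) JS(1)]] G_def C(2) JS(3) by auto
  obtain N where N: "N > 0" "\<And>x. norm (G x) \<le> N * norm x"
    using Gb by (metis bounded_linear.pos_bounded mult.commute)
  have BC: "(C u, C v) \<in> B" if "(u, v) \<in> B" for u v
    using comm that commutes_iff[OF sv] by auto
  have form: "cinner v (G u) = cinner u (G v)" if "(u, v) \<in> B" for u v
    using J_selfadjoint_form[OF B BC[OF that] that] by (simp add: G_def)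
  define K where "K k = M * N / \<bar>Im k\<bar>" for k
  \<comment> \<open>Stated for every nonreal \<open>k\<close>, since it is applied both at
    \<open>l\<close> and at its conjugate. The estimate compares the imaginary part of
    \<open>cinner u (G ?f)\<close> with coercivity.\<close>
  have bound: "norm u \<le> K k * norm (v - scaleC k u)" if k: "Im k \<noteq> 0" and uv: "(u, v) \<in> B" for k u v
  proof (cases "u = 0")
    case False
    let ?f = "v - scaleC k u"
    have "cnj (cinner u (G v)) = cinner u (G v)"
      using form[OF uv] by (metis Gsym cinner_commute)
    then have im: "Im (cinner u (G v)) = 0" by (simp add: complex_eq_iff)
    have im': "Im (cinner u (G u)) = 0" using G False by (auto simp: positive_op_def Gsym)
    have "cinner u (G ?f) = cinner u (G v) - k * cinner u (G u)"
      by (simp add: Gl cinner_diff_right cinner_scaleC_right)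
    then have "Im (cinner u (G ?f)) = - Im k * Re (cinner u (G u))" using im im' by simp
    then have "\<bar>Im k\<bar> * Re (cinner u (G u)) \<le> \<bar>Im (cinner u (G ?f))\<bar>"
      by (simp add: abs_mult mult_left_mono)
    also have "\<dots> \<le> norm u * norm (G ?f)"
      using abs_Im_le_cmod norm_cinner_le order_trans by blast
    also have "\<dots> \<le> norm u * (N * norm ?f)" by (intro mult_left_mono N) simp
    finally have a: "\<bar>Im k\<bar> * Re (cinner u (G u)) \<le> norm u * (N * norm ?f)" .
    have "\<bar>Im k\<bar> * (norm u)\<^sup>2 \<le> \<bar>Im k\<bar> * (M * Re (cinner u (G u)))"
      by (intro mult_left_mono M) simp
    also have "\<dots> \<le> M * (norm u * (N * norm ?f))"
      using mult_left_mono[OF a, of M] M(1) by (simp add: algebra_simps)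
    finally have "norm u * (\<bar>Im k\<bar> * norm u) \<le> norm u * (M * N * norm ?f)"
      by (simp add: algebra_simps power2_eq_square)
    then have "\<bar>Im k\<bar> * norm u \<le> M * N * norm ?f" using False by simp
    then show ?thesis using k by (simp add: K_def field_simps)
  qed (use M N in \<open>simp add: K_def\<close>)
  have diff: "v - v' - scaleC k (u - u') = v - scaleC k u - (v' - scaleC k u')" for k and u v u' v' :: 'a
    by (simp add: cvec.scale_right_diff_distrib)
  have inj: "u = u'" if "Im k \<noteq> 0" "(u, v) \<in> B" "(u', v') \<in> B" "v - scaleC k u = v' - scaleC k u'"
    for k u v u' v'
  proof -
    have "(u - u', v - v') \<in> B" by (rule is_operator_diff[OF op that(2,3)])
    from bound[OF that(1) this] have "norm (u - u') \<le> K k * norm (v - scaleC k u - (v' - scaleC k u'))"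
      by (simp only: diff)
    also have "\<dots> = 0" unfolding that(4) by simp
    finally show ?thesis by simp
  qed
  define R where "R = {v - scaleC l u | u v. (u, v) \<in> B}"
  have "csubspace R"
    unfolding csubspace_def
  proof (intro conjI ballI allI)
    have "(0, 0) \<in> B" using op by (simp add: is_operator_def)
    moreover have "0 = 0 - scaleC l (0 :: 'a)" by simp
    ultimately show "0 \<in> R" unfolding R_def by blast
  next
    fix x y assume "x \<in> R" "y \<in> R"
    then obtain u v u' v' where "(u, v) \<in> B" "(u', v') \<in> B" "x = v - scaleC l u" "y = v' - scaleC l u'"
      by (auto simp: R_def)
    moreover from this have "(u + u', v + v') \<in> B" using op unfolding is_operator_def by blast
    moreover from calculation have "x + y = v + v' - scaleC l (u + u')" by (simp add: scaleC_add_right)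
    ultimately show "x + y \<in> R" unfolding R_def by blast
  next
    fix c x assume "x \<in> R"
    then obtain u v where "(u, v) \<in> B" "x = v - scaleC l u" by (auto simp: R_def)
    moreover from this have "(scaleC c u, scaleC c v) \<in> B" using op unfolding is_operator_def by blast
    moreover from calculation have "scaleC c x = scaleC c v - scaleC l (scaleC c u)"
      by (simp add: cvec.scale_right_diff_distrib scaleC_scaleC mult.commute)
    ultimately show "scaleC c x \<in> R" unfolding R_def by blast
  qed
  \<comment> \<open>By \<open>bound\<close>, preimages of a convergent sequence in \<open>R\<close>
    are Cauchy; maximality of \<open>B\<close> puts the limit pair into the graph.\<close>
  moreover have "closed R"
    unfolding closed_sequential_limits
  proof (intro allI impI, elim conjE)
    fix f y assume f: "\<forall>n. f n \<in> R" and lim: "f \<longlonglongrightarrow> y"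
    then obtain u v where uv: "\<And>n. (u n, v n) \<in> B" "\<And>n. f n = v n - scaleC l (u n)"
      unfolding R_def mem_Collect_eq by metis
    have K0: "K l > 0" using M N l by (simp add: K_def)
    have le: "norm (u m - u n) \<le> K l * norm (f m - f n)" for m n
      using bound[OF l is_operator_diff[OF op uv(1) uv(1)], of m n]
      by (simp only: uv(2) diff)
    have "Cauchy u"
    proof (rule metric_CauchyI)
      fix e :: real assume "e > 0"
      then have "e / K l > 0" using K0 by simp
      moreover have "Cauchy f" using lim LIMSEQ_imp_Cauchy by blast
      ultimately obtain n0 where "\<And>m n. m \<ge> n0 \<Longrightarrow> n \<ge> n0 \<Longrightarrow> dist (f m) (f n) < e / K l"
        by (meson metric_CauchyD)
      then have "K l * norm (f m - f n) < e" if "m \<ge> n0" "n \<ge> n0" for m n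
        using that K0 by (simp add: dist_norm field_simps)
      then have "dist (u m) (u n) < e" if "m \<ge> n0" "n \<ge> n0" for m n
        unfolding dist_norm using le[of m n] that by (meson le_less_trans)
      then show "\<exists>n0. \<forall>m\<ge>n0. \<forall>n\<ge>n0. dist (u m) (u n) < e" by blast
    qed
    then obtain a where a: "u \<longlonglongrightarrow> a" using Cauchy_convergent_iff convergent_def by blast
    let ?b = "y + scaleC l a"
    have "(\<lambda>n. f n + scaleC l (u n)) \<longlonglongrightarrow> ?b"
      by (intro tendsto_add lim bounded_linear.tendsto[OF bounded_linear_scaleC] a)
    then have b: "v \<longlonglongrightarrow> ?b" by (simp add: uv(2))
    note Jt = bounded_linear.tendsto[OF cbounded_linear_bounded_linear[OF JS(1)]]
    have "cinner v' (J a) = cinner u' (J ?b)" if "(u', v') \<in> B" for u' v'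
    proof (rule LIMSEQ_unique)
      show "(\<lambda>n. cinner v' (J (u n))) \<longlonglongrightarrow> cinner v' (J a)"
        by (intro bounded_bilinear.tendsto[OF bounded_bilinear_cinner] tendsto_const Jt a)
      have "(\<lambda>n. cinner u' (J (v n))) \<longlonglongrightarrow> cinner u' (J ?b)"
        by (intro bounded_bilinear.tendsto[OF bounded_bilinear_cinner] tendsto_const Jt b)
      then show "(\<lambda>n. cinner v' (J (u n))) \<longlonglongrightarrow> cinner u' (J ?b)"
        by (simp add: J_selfadjoint_form[OF B uv(1) that])
    qed
    from J_selfadjoint_maximal[OF B J this] have "(a, ?b) \<in> B" by (simp add: JS)
    moreover have "y = ?b - scaleC l a" by simp
    ultimately show "y \<in> R" unfolding R_def by blast
  qed
  \<comment> \<open>Orthogonality to the range makes \<open>J z\<close> a solution of the eigenvalue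
    equation at \<open>cnj l\<close>, so \<open>bound\<close> forces it to be zero.\<close>
  moreover have "z = 0" if z: "z \<in> ortho_compl R" for z
  proof -
    have "cinner v z = cinner u (scaleC (cnj l) z)" if "(u, v) \<in> B" for u v
    proof -
      have "v - scaleC l u \<in> R" using that by (auto simp: R_def)
      then have "cinner (v - scaleC l u) z = 0" using z by (auto simp: ortho_compl_def)
      then show ?thesis by (simp add: cinner_diff_left cinner_scaleC_left cinner_scaleC_right)
    qed
    then have "(J z, J (scaleC (cnj l) z)) \<in> B"
      by (intro J_selfadjoint_maximal[OF B J]) (simp add: JS)
    then have "(J z, scaleC (cnj l) (J z)) \<in> B"
      by (simp add: clinear_simps[OF cbounded_linear_clinear[OF JS(1)]])
    from bound[OF _ this, of "cnj l"] l have "J z = 0" by simp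
    then show ?thesis
      using JS(3)[of z] clinear_simps(4)[OF cbounded_linear_clinear[OF JS(1)]] by simp
  qed
  ultimately have "y \<in> R" for y
    using ortho_compl_ortho_compl[of R y] by (metis cinner_zero_left)
  then have "\<exists>u v. (u, v) \<in> B \<and> v - scaleC l u = y" for y
    unfolding R_def mem_Collect_eq by metis
  then show ?thesis using inj[OF l] bound[OF l] by (intro resolvent_setI[OF sv, where K = "K l"]) blast+
qed

text \<open>The graph is parametrized by \<open>x\<close>, and the sum and difference of
  \<open>U x\<close> and \<open>x\<close> determine both, so commutation can be read off from the
  restricted shift.\<close>

lemma phillips_op_commutes_iff:
  fixes U C :: "'a::chilbert \<Rightarrow> 'a"
  assumes sv: "single_valued (phillips_op U W)" and C: "clinear C"
  shows "commutes (phillips_op U W) C \<longleftrightarrow>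
    (\<forall>x\<in>ortho_compl W. C x \<in> ortho_compl W \<and> C (U x) = U (C x))"
proof
  assume c: "commutes (phillips_op U W) C"
  show "\<forall>x\<in>ortho_compl W. C x \<in> ortho_compl W \<and> C (U x) = U (C x)"
  proof
    fix x assume x: "x \<in> ortho_compl W"
    then have "(U x - x, scaleC \<i> (U x + x)) \<in> phillips_op U W"
      by (auto simp: phillips_op_def)
    then have "(C (U x - x), C (scaleC \<i> (U x + x))) \<in> phillips_op U W"
      using c commutes_iff[OF sv] by auto
    then obtain y where y: "y \<in> ortho_compl W" "C (U x) - C x = U y - y"
      "scaleC \<i> (C (U x) + C x) = scaleC \<i> (U y + y)"
      by (auto simp: phillips_op_def clinear_simps[OF C])
    have s: "C (U x) + C x = U y + y" using y(3) by simp
    have "scaleR 2 (C x) = C (U x) + C x - (C (U x) - C x)" by (simp add: scaleR_2)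
    also have "\<dots> = scaleR 2 y" unfolding s y(2) by (simp add: scaleR_2)
    finally have "C x = y" by simp
    then show "C x \<in> ortho_compl W \<and> C (U x) = U (C x)" using y s by simp
  qed
next
  assume c: "\<forall>x\<in>ortho_compl W. C x \<in> ortho_compl W \<and> C (U x) = U (C x)"
  show "commutes (phillips_op U W) C"
    unfolding commutes_iff[OF sv]
  proof clarify
    fix u v assume "(u, v) \<in> phillips_op U W"
    then obtain x where x: "x \<in> ortho_compl W" "u = U x - x" "v = scaleC \<i> (U x + x)"
      by (auto simp: phillips_op_def)
    have "C u = U (C x) - C x" "C v = scaleC \<i> (U (C x) + C x)"
      using c x by (simp_all add: clinear_simps[OF C])
    then show "(C u, C v) \<in> phillips_op U W"
      using c x(1) by (auto simp: phillips_op_def)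
  qed
qed

section \<open>The Cayley transform and the construction of a stable C-symmetry\<close>

lemma unitary_inverse:
  fixes U :: "'a::chilbert \<Rightarrow> 'a"
  assumes "unitary U"
  shows "cbounded_linear U" "cinner (U x) (U y) = cinner x y" "U (inv U x) = x" "inv U (U x) = x"
    "cbounded_linear (inv U)"
proof -
  show U: "cbounded_linear U" and iso: "cinner (U x) (U y) = cinner x y" for x y
    using assms by (auto simp: unitary_def)
  note lin = clinear_simps[OF cbounded_linear_clinear[OF U]]
  show UV: "U (inv U x) = x" for x using assms by (simp add: unitary_def surj_f_inv_f)
  have nrm: "norm (U x) = norm x" for x by (simp add: norm_eq_sqrt_cinner iso)
  have "inj U"
  proof (rule injI)
    fix x y assume "U x = U y"
    then have "norm (U (x - y)) = 0" by (simp add: lin)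
    then show "x = y" by (simp add: nrm)
  qed
  then show VU: "inv U (U x) = x" for x by simp
  have "inv U (x + y) = inv U x + inv U y" for x y
    using VU[of "inv U x + inv U y"] by (simp add: lin UV)
  moreover have "inv U (scaleC c x) = scaleC c (inv U x)" for c x
    using VU[of "scaleC c (inv U x)"] by (simp add: lin UV)
  moreover have "norm (inv U x) \<le> 1 * norm x" for x
    using nrm[of "inv U x"] by (simp add: UV)
  ultimately show "cbounded_linear (inv U)"
    unfolding cbounded_linear_def clinear_def by blast
qed

text \<open>On a graph pair (p - q, i(p + q)), B - i gives 2iq and B + i gives 2ip. The two
  resolvents thus solve the same relation for \<open>p\<close> and for \<open>q\<close>, so
  \<open>K\<close> and \<open>L\<close> are mutually inverse.\<close>

lemma cayley_transform:
  fixes B :: "'a::chilbert operator"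
  assumes op: "is_operator B" and i: "\<i> \<in> resolvent_set B" "- \<i> \<in> resolvent_set B"
  shows "\<exists>K L. cbounded_linear K \<and> cbounded_linear L \<and> (\<forall>x. K (L x) = x \<and> L (K x) = x) \<and>
    (\<forall>p q. (p - q, scaleC \<i> (p + q)) \<in> B \<longleftrightarrow> p = K q)"
proof -
  obtain R where R: "cbounded_linear R" "\<And>y. (R y, y + scaleC \<i> (R y)) \<in> B"
    "\<And>u v. (u, v) \<in> B \<Longrightarrow> R (v - scaleC \<i> u) = u"
    using resolvent_exists[OF op i(1)] by blast
  obtain Q where Q: "cbounded_linear Q" "\<And>y. (Q y, y + scaleC (- \<i>) (Q y)) \<in> B"
    "\<And>u v. (u, v) \<in> B \<Longrightarrow> Q (v - scaleC (- \<i>) u) = u"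
    using resolvent_exists[OF op i(2)] by blast
  define K where "K q = q + R (scaleC (2 * \<i>) q)" for q
  define L where "L p = p - Q (scaleC (2 * \<i>) p)" for p
  have two: "scaleC (2 * \<i>) x = scaleC \<i> x + scaleC \<i> x" for x :: 'a
    by (simp flip: scaleC_add_left)
  have K: "(p - q, scaleC \<i> (p + q)) \<in> B \<longleftrightarrow> p = K q" for p q
  proof
    assume "(p - q, scaleC \<i> (p + q)) \<in> B"
    from R(3)[OF this] show "p = K q"
      by (simp add: K_def two scaleC_add_right cvec.scale_right_diff_distrib)
  next
    assume p: "p = K q"
    show "(p - q, scaleC \<i> (p + q)) \<in> B"
      using R(2)[of "scaleC (2 * \<i>) q"] unfolding p K_def two by (simp add: scaleC_add_right algebra_simps)
  qed
  have L: "(p - q, scaleC \<i> (p + q)) \<in> B \<longleftrightarrow> q = L p" for p q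
  proof
    assume "(p - q, scaleC \<i> (p + q)) \<in> B"
    from Q(3)[OF this] show "q = L p"
      by (simp add: L_def two scaleC_add_right cvec.scale_right_diff_distrib)
  next
    assume q: "q = L p"
    show "(p - q, scaleC \<i> (p + q)) \<in> B"
      using Q(2)[of "scaleC (2 * \<i>) p"] unfolding q L_def two
      by (simp add: scaleC_add_right cvec.scale_right_diff_distrib algebra_simps)
  qed
  have "cbounded_linear K" unfolding K_def[abs_def]
    by (rule cbounded_linear_add[OF cbounded_linear_ident cbounded_linear_compose[OF R(1) cbounded_linear_scaleC]])
  moreover have "cbounded_linear L" unfolding L_def[abs_def]
    by (rule cbounded_linear_diff[OF cbounded_linear_ident cbounded_linear_compose[OF Q(1) cbounded_linear_scaleC]])
  moreover have "K (L x) = x" "L (K x) = x" for x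
    using K[of x "L x"] L[of x "L x"] K[of "K x" x] L[of "K x" x] by simp_all
  ultimately show ?thesis using K by blast
qed

lemma real_spectrum_imp_stable_C_symmetry:
  fixes U J :: "'a::chilbert \<Rightarrow> 'a"
  assumes shift: "bilateral_shift U W0" and J: "fundamental_symmetry J"
    and JS: "commutes (phillips_op U W0) J" and B: "J_selfadjoint J B"
    and ext: "phillips_op U W0 \<subseteq> B"
    and i: "\<i> \<in> resolvent_set B" "- \<i> \<in> resolvent_set B"
  shows "stable_C_symmetry J (phillips_op U W0) B"
proof -
  define V where "V = inv U"
  have unit: "unitary U" and W0: "csubspace W0" "closed W0" using shift by (auto simp: bilateral_shift_def)
  note U = unitary_inverse[OF unit, folded V_def]
  note Jf = fundamental_symmetry_simps[OF J]
  have op: "is_operator B" using B by (simp add: J_selfadjoint_def)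
  note svB = is_operator_single_valued[OF op]
  have sv: "single_valued (phillips_op U W0)" using svB ext by (rule single_valued_subset[rotated])
  have J_perp: "J x \<in> ortho_compl W0" "J (U x) = U (J x)" if "x \<in> ortho_compl W0" for x
    using JS phillips_op_commutes_iff[OF sv cbounded_linear_clinear[OF Jf(1)]] that by auto
  obtain K L where K: "cbounded_linear K" "cbounded_linear L" "\<And>x. K (L x) = x" "\<And>x. L (K x) = x"
    and KB: "\<And>p q. (p - q, scaleC \<i> (p + q)) \<in> B \<longleftrightarrow> p = K q"
    using cayley_transform[OF op i] by blast
  have K_perp: "K x = U x" if "x \<in> ortho_compl W0" for x
  proof -
    have "(U x - x, scaleC \<i> (U x + x)) \<in> B" using that ext by (auto simp: phillips_op_def)
    then show ?thesis by (simp add: KB)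
  qed
  \<comment> \<open>Symmetry of \<open>B\<close> at two Cayley pairs; on expansion the mixed terms
    cancel, leaving twice the difference of the two sides.\<close>
  have K_form: "cinner (K x) (J (K y)) = cinner x (J y)" for x y
  proof -
    have "(K x - x, scaleC \<i> (K x + x)) \<in> B" "(K y - y, scaleC \<i> (K y + y)) \<in> B"
      by (simp_all add: KB)
    from J_selfadjoint_form[OF B this(2,1)]
    have "- \<i> * cinner (K x + x) (J (K y - y)) = \<i> * cinner (K x - x) (J (K y + y))"
      by (simp add: clinear_simps[OF cbounded_linear_clinear[OF Jf(1)]] cinner_scaleC_left cinner_scaleC_right)
    then have "\<i> * (cinner (K x + x) (J (K y - y)) + cinner (K x - x) (J (K y + y))) = \<i> * 0"
      unfolding distrib_left by (metis add.right_inverse mult_minus_left mult_zero_right)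
    then have "cinner (K x + x) (J (K y - y)) + cinner (K x - x) (J (K y + y)) = 0" by simp
    then show ?thesis
      by (simp add: clinear_simps[OF cbounded_linear_clinear[OF Jf(1)]]
          cinner_add_left cinner_add_right cinner_diff_left cinner_diff_right)
  qed
  \<comment> \<open>Testing against y orthogonal to \<open>W0\<close>: \<open>K_form\<close> at
    \<open>J y\<close>, where \<open>K\<close> is \<open>U\<close> and \<open>J\<close> commutes
    with \<open>U\<close>, gives equal products with \<open>V (K x)\<close> and
    \<open>x\<close>.\<close>
  have V_K: "V (K x) - x \<in> W0" for x
  proof (rule ortho_compl_ortho_compl[OF W0])
    fix y assume y: "y \<in> ortho_compl W0"
    have "cinner (K (J y)) (J (K x)) = cinner (J y) (J x)" by (rule K_form)
    then have "cinner (U y) (K x) = cinner y x"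
      using K_perp[OF J_perp(1)[OF y]] J_perp(2)[OF y, symmetric] by (simp add: Jf)
    then have "cinner y (V (K x)) = cinner y x" using U(2)[of y "V (K x)"] U(3)[of "K x"] by simp
    then show "cinner y (V (K x) - x) = 0" by (simp add: cinner_diff_right)
  qed
  interpret phillips_cayley U V W0 J K L
  proof
    show "csubspace (U ` W0)"
      unfolding csubspace_def
    proof (intro conjI ballI allI)
      note lin = clinear_simps[OF cbounded_linear_clinear[OF U(1)]]
      show "0 \<in> U ` W0" using W0(1) image_eqI[of 0 U 0 W0] by (simp add: csubspace_def lin(4))
      show "x + y \<in> U ` W0" if "x \<in> U ` W0" "y \<in> U ` W0" for x y
        using that W0(1) by (auto simp: csubspace_def lin(1)[symmetric])
      show "scaleC c x \<in> U ` W0" if "x \<in> U ` W0" for c x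
        using that W0(1) by (auto simp: csubspace_def lin(3)[symmetric])
    qed
    have "U ` W0 = V -` W0"
      using U(3,4) by (auto simp: image_iff) metis
    moreover have "continuous_on UNIV V"
      using cbounded_linear_bounded_linear[OF U(5)] linear_continuous_on by blast
    ultimately show "closed (U ` W0)" using closed_vimage[OF W0(2)] by simp
    have wander: "cinner ((U ^^ Suc n) x) y = 0" if "x \<in> W0" "y \<in> W0" for x y n
    proof -
      have "zpow U (int (Suc n)) x = (U ^^ Suc n) x" "zpow U 0 y = y" by (simp_all add: zpow_def del: of_nat_Suc)
      moreover have "\<forall>x\<in>zpow U (int (Suc n)) ` W0. \<forall>y\<in>zpow U 0 ` W0. cinner x y = 0"
        using shift unfolding bilateral_shift_def
        by (metis of_nat_0 of_nat_eq_iff nat.distinct(1))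
      ultimately show ?thesis using that by (metis imageI)
    qed
    show "cinner ((U ^^ Suc n) x) y = 0" if xy: "x \<in> U ` W0" "y \<in> U ` W0" for n x y
    proof -
      obtain a b where ab: "a \<in> W0" "b \<in> W0" "x = U a" "y = U b" using xy by blast
      have "(U ^^ Suc n) x = U ((U ^^ Suc n) a)" using ab(3) by (simp add: funpow_swap1)
      then show ?thesis using wander[OF ab(1,2)] ab(4) U(2) by metis
    qed
  qed (use U W0 Jf J_perp K K_perp V_K K_form in auto)
  have "commutes B stable_C"
    unfolding commutes_iff[OF svB]
  proof clarify
    fix u v assume uv: "(u, v) \<in> B"
    \<comment> \<open>Solves p - q = u and i(p + q) = v, so that the pair takes Cayley form.\<close>
    define q where "q = scaleR (- 1 / 2) (u + scaleC \<i> v)"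
    define p where "p = u + q"
    have pq: "scaleC \<i> (p + q) = v"
    proof -
      have "p + q = u + scaleR 2 q" by (simp add: p_def scaleR_2)
      also have "\<dots> = - scaleC \<i> v" by (simp add: q_def)
      finally show ?thesis by (simp add: scaleC_scaleC flip: cvec.scale_minus_left)
    qed
    have u: "p - q = u" by (simp add: p_def)
    have "p = K q" using KB[of p q] uv by (simp add: pq u)
    then have "stable_C p = K (stable_C q)" by (simp add: stable_C_K)
    then have "(stable_C p - stable_C q, scaleC \<i> (stable_C p + stable_C q)) \<in> B" by (simp add: KB)
    then show "(stable_C u, stable_C v) \<in> B"
      unfolding pq[symmetric] u[symmetric]
      by (simp add: clinear_simps[OF cbounded_linear_clinear[OF cbounded_linear_stable_C]])
  qed
  moreover have "commutes (phillips_op U W0) stable_C"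
    unfolding phillips_op_commutes_iff[OF sv cbounded_linear_clinear[OF cbounded_linear_stable_C]]
    using stable_C_perp stable_C_U by blast
  ultimately show ?thesis
    unfolding stable_C_symmetry_def
    using cbounded_linear_stable_C stable_C_involution positive_J_stable_C by blast
qed

theorem theorem3p9:
  fixes U J :: "'a::chilbert \<Rightarrow> 'a" and W0 :: "'a set" and B :: "'a operator"
  assumes "bilateral_shift U W0"
    and "cdim_is W0 2"
    and "fundamental_symmetry J"
    and "commutes (phillips_op U W0) J"
    and "J_selfadjoint J B"
    and "phillips_op U W0 \<subseteq> B"
  shows "stable_C_symmetry J (phillips_op U W0) B \<longleftrightarrow> (\<forall>z\<in>spectrum_op B. Im z = 0)"
proof
  assume "stable_C_symmetry J (phillips_op U W0) B"
  then show "\<forall>z\<in>spectrum_op B. Im z = 0"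
    using C_symmetry_imp_real_spectrum[OF assms(3,5)]
    by (auto simp: stable_C_symmetry_def spectrum_op_def)
next
  assume real: "\<forall>z\<in>spectrum_op B. Im z = 0"
  have "z \<in> resolvent_set B" if "Im z \<noteq> 0" for z
    using real that by (auto simp: spectrum_op_def)
  then have "\<i> \<in> resolvent_set B" "- \<i> \<in> resolvent_set B" by simp_all
  then show "stable_C_symmetry J (phillips_op U W0) B"
    by (rule real_spectrum_imp_stable_C_symmetry[OF assms(1,3,4,5,6)])
qed

end
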